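(* The only $3$-dimensional linear subspaces of $\mathbb C^6$ contained in $L_{2,4}$ are the $60$ three-dimensional linear subspaces whose union is the singular locus of $L_{2,4}$. Moreover, $L_{2,4}$ contains no linear subspace of dimension $\ge 4$.
   Context: Coordinates of $\mathbb C^6$ are $l_{ij}$ indexed by the edges $\{i,j\}$ of $K_4$. $L_{2,4}$ is the set of $l\in\mathbb C^6$ such that $(l_{ij}^2)$ equals $(\sum_{k=1}^2({\bf p}_i^k-{\bf p}_j^k)^2)$ for some complex configuration ${\bf p}_1,\dots,{\bf p}_4\in\mathbb C^2$; it is the hypersurface cut out by the determinant of the symmetric $3\times3$ matrix with diagonal $2l_{14}^2,2l_{24}^2,2l_{34}^2$ and off-diagonal entries $l_{14}^2+l_{24}^2-l_{12}^2$, $l_{14}^2+l_{34}^2-l_{13}^2$, $l_{24}^2+l_{34}^2-l_{23}^2$. Its singular locus is a union of 60 three-dimensional linear subspaces: the 32 subspaces $\{l_{12}-s_{13}l_{13}+s_{23}l_{23}=0,\ l_{12}-s_{14}l_{14}+s_{24}l_{24}=0,\ s_{13}l_{13}-s_{14}l_{14}+s_{34}l_{34}=0\}$ with $s_{ij}\in\{\pm1\}$; the 24 subspaces $\{l_{ab}=0,\ l_{ac}=\pm l_{bc},\ l_{ae}=\pm l_{be}\}$ for an edge $\{a,b\}$ and $\{c,e\}$ the remaining vertices; and the 4 subspaces $\{l_{ab}=l_{ac}=l_{bc}=0\}$ for triangles $\{a,b,c\}$. *)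

theory Defs
  imports "HOL-Analysis.Analysis"
begin

text \<open>C^6 with coordinates l_ij indexed by the edges of K_4 (vertices 1..4).
  Coordinate order: l12, l13, l14, l23, l24, l34 are components 1,2,3,4,5,6.\<close>

definition el :: "complex ^ 6 \<Rightarrow> nat \<Rightarrow> nat \<Rightarrow> complex" where
  "el x i j =
    (if {i,j} = {1,2} then x $ 1
     else if {i,j} = {1,3} then x $ 2
     else if {i,j} = {1,4} then x $ 3
     else if {i,j} = {2,3} then x $ 4
     else if {i,j} = {2,4} then x $ 5
     else x $ 6)"

definition L24 :: "(complex ^ 6) set" where
  "L24 = {x. \<exists>p :: nat \<Rightarrow> nat \<Rightarrow> complex.
            \<forall>i\<in>{1..4}. \<forall>j\<in>{1..4}. i < j \<longrightarrow>
              (el x i j)\<^sup>2 = (\<Sum>k\<in>{1,2::nat}. (p i k - p j k)\<^sup>2)}"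

definition signs :: "complex set" where "signs = {1, -1}"

definition singA :: "complex \<Rightarrow> complex \<Rightarrow> complex \<Rightarrow> complex \<Rightarrow> complex \<Rightarrow> (complex ^ 6) set" where
  "singA s13 s14 s23 s24 s34 =
     {x. el x 1 2 - s13 * el x 1 3 + s23 * el x 2 3 = 0
       \<and> el x 1 2 - s14 * el x 1 4 + s24 * el x 2 4 = 0
       \<and> s13 * el x 1 3 - s14 * el x 1 4 + s34 * el x 3 4 = 0}"

definition singB :: "nat \<Rightarrow> nat \<Rightarrow> nat \<Rightarrow> nat \<Rightarrow> complex \<Rightarrow> complex \<Rightarrow> (complex ^ 6) set" where
  "singB a b c e \<sigma> \<tau> =
     {x. el x a b = 0 \<and> el x a c = \<sigma> * el x b c \<and> el x a e = \<tau> * el x b e}"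

definition singC :: "nat \<Rightarrow> nat \<Rightarrow> nat \<Rightarrow> (complex ^ 6) set" where
  "singC a b c = {x. el x a b = 0 \<and> el x a c = 0 \<and> el x b c = 0}"

definition sing_components :: "(complex ^ 6) set set" where
  "sing_components =
     {singA s13 s14 s23 s24 s34 | s13 s14 s23 s24 s34.
        s13 \<in> signs \<and> s14 \<in> signs \<and> s23 \<in> signs \<and> s24 \<in> signs \<and> s34 \<in> signs}
   \<union> {singB a b c e \<sigma> \<tau> | a b c e \<sigma> \<tau>.
        distinct [a, b, c, e] \<and> {a, b, c, e} = {1..4} \<and> \<sigma> \<in> signs \<and> \<tau> \<in> signs}
   \<union> {singC a b c | a b c. distinct [a, b, c] \<and> {a, b, c} \<subseteq> {1..4}}"

end

theory Submission
  imports Defs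
begin

text \<open>Let V be a linear subspace of dimension at least 3 on which the Cayley-Menger determinant
  vanishes. As a quadratic polynomial in the square of one edge length, the determinant has
  discriminant \<open>H\<^sub>T H\<^sub>S\<close>, where T and S are the two triangles at the opposite edge and each Heron
  expression H is a product of four linear forms. Hence \<open>H\<^sub>T H\<^sub>S\<close> is a square on V, and every simple
  factor of \<open>H\<^sub>T\<close> is proportional to a factor of \<open>H\<^sub>S\<close>. If no Heron factor vanished on V, this would
  force the factors of all four triangles to coincide up to sign, which leads to a contradiction. So
  some triangle is degenerate on V, say \<open>x + y + z = 0\<close> for its signed edge lengths. There the
  determinant is minus the square of the Segre cubic \<open>x f\<^sup>2 + y b\<^sup>2 + z d\<^sup>2 + x y z\<close>, whose planes are found
  by restricting it to \<open>x = 0\<close> and to \<open>y = 0\<close>.\<close>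

section \<open>The Cayley-Menger determinant and Heron factors\<close>

text \<open>For the squared edge lengths 12, 13, 14, 23, 24, 34 this is 144 times the squared volume
  of the tetrahedron, half of the Cayley-Menger determinant. The pairs \<open>A F\<close>,
  \<open>B E\<close>, \<open>C D\<close> are opposite edges; the last four products belong to the
  triangles.\<close>

definition cm :: "complex \<Rightarrow> complex \<Rightarrow> complex \<Rightarrow> complex \<Rightarrow> complex \<Rightarrow> complex \<Rightarrow> complex" where
  "cm A B C D E F = A * F * (B + E + C + D - A - F) + B * E * (A + F + C + D - B - E)
     + C * D * (A + F + B + E - C - D) - A * B * D - A * C * E - B * C * F - D * E * F"

text \<open>Translating the fourth point to the origin leaves a polynomial identity in six
  variables.\<close>

lemma cm_planar:
  "cm ((x1 - x2)\<^sup>2 + (y1 - y2)\<^sup>2) ((x1 - x3)\<^sup>2 + (y1 - y3)\<^sup>2) ((x1 - x4)\<^sup>2 + (y1 - y4)\<^sup>2)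
      ((x2 - x3)\<^sup>2 + (y2 - y3)\<^sup>2) ((x2 - x4)\<^sup>2 + (y2 - y4)\<^sup>2) ((x3 - x4)\<^sup>2 + (y3 - y4)\<^sup>2) = 0"
proof -
  have gen: "cm ((u1 - u2)\<^sup>2 + (w1 - w2)\<^sup>2) ((u1 - u3)\<^sup>2 + (w1 - w3)\<^sup>2) (u1\<^sup>2 + w1\<^sup>2)
      ((u2 - u3)\<^sup>2 + (w2 - w3)\<^sup>2) (u2\<^sup>2 + w2\<^sup>2) (u3\<^sup>2 + w3\<^sup>2) = 0" for u1 u2 u3 w1 w2 w3
    unfolding cm_def by algebra
  show ?thesis
    using gen[of "x1 - x4" "x2 - x4" "y1 - y4" "y2 - y4" "x3 - x4" "y3 - y4"] by simp
qed

text \<open>By Heron's formula the product of the four values is -16 times the squared area of the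
  triangle. The overall sign of the factor with index 0 is chosen so that the four forms sum to
  zero.\<close>

definition heron :: "complex \<Rightarrow> complex \<Rightarrow> complex \<Rightarrow> nat \<Rightarrow> complex" where
  "heron a b d k = (if k = 0 then - a - b - d else if k = 1 then - a + b + d
     else if k = 2 then a - b + d else a + b - d)"

lemma lessThan_4: "{..<4} = {0, 1, 2, 3 :: nat}"
  by auto

lemma lessThan_4_complete_pair:
  fixes i j :: nat
  assumes "i < 4" "j < 4" "i \<noteq> j"
  obtains p q where "p < 4" "q < 4" "distinct [i, j, p, q]" "{..<4} = {i, j, p, q}"
proof -
  have "card ({..<4} - {i, j}) = 2" using assms by (subst card_Diff_subset) auto
  then obtain p q where "{..<4} - {i, j} = {p, q}" "p \<noteq> q" by (auto simp: card_2_iff)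
  then have "{..<4} = {i, j, p, q}" "p \<in> {..<4} - {i, j}" "q \<in> {..<4} - {i, j}" "p \<noteq> q"
    using assms(1,2) by blast+
  then show ?thesis using that[of p q] assms(3) by (simp only: Diff_iff lessThan_iff) auto
qed

lemma heron_sum: "(\<Sum>k<4. heron a b d k) = 0"
  by (simp add: lessThan_4 heron_def)

lemma heron_sum_squares: "(\<Sum>k<4. (heron a b d k)\<^sup>2) = 4 * (a\<^sup>2 + b\<^sup>2 + d\<^sup>2)"
  by (simp add: lessThan_4 heron_def power2_eq_square algebra_simps)

lemma heron_eq_0_iff: "(\<forall>k<4. heron a b d k = 0) \<longleftrightarrow> a = 0 \<and> b = 0 \<and> d = 0"
proof
  assume *: "\<forall>k<4. heron a b d k = 0"
  have "heron a b d 1 = 0" "heron a b d 2 = 0" "heron a b d 3 = 0"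
    using * by simp_all
  then have "- a + b + d = 0" "a - b + d = 0" "a + b - d = 0"
    by (simp_all add: heron_def)
  then show "a = 0 \<and> b = 0 \<and> d = 0"
    by algebra
qed (simp add: heron_def)

text \<open>Every factor has an odd number of minus signs, so two different factors agree in exactly
  one sign, and the other two sides cancel.\<close>

lemma heron_pair_sum:
  assumes "k < 4" "m < 4" "k \<noteq> m"
  obtains s where "s = 2 \<or> s = -2"
    "(\<forall>a b d. heron a b d k + heron a b d m = s * a) \<or> (\<forall>a b d. heron a b d k + heron a b d m = s * b)
      \<or> (\<forall>a b d. heron a b d k + heron a b d m = s * d)"
proof -
  have "k \<in> {0, 1, 2, 3}" "m \<in> {0, 1, 2, 3}"
    using assms by auto
  then have "\<exists>s. (s = 2 \<or> s = -2) \<and> ((\<forall>a b d. heron a b d k + heron a b d m = s * a)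
      \<or> (\<forall>a b d. heron a b d k + heron a b d m = s * b) \<or> (\<forall>a b d. heron a b d k + heron a b d m = s * d))"
    using assms(3) by (elim insertE emptyE; simp add: heron_def; force)
  then show ?thesis
    using that by blast
qed

text \<open>Completing the square: as a quadratic in \<open>f\<^sup>2\<close>, \<open>cm\<close> has
  leading coefficient \<open>- a\<^sup>2\<close>, the bracket subtracted on the left is its linear
  coefficient, and the right-hand side is its discriminant.\<close>

lemma cm_discriminant:
  assumes "cm (a\<^sup>2) (b\<^sup>2) (c\<^sup>2) (d\<^sup>2) (e\<^sup>2) (f\<^sup>2) = 0"
  shows "(2 * a\<^sup>2 * f\<^sup>2 - (a\<^sup>2 * (b\<^sup>2 + c\<^sup>2 + d\<^sup>2 + e\<^sup>2 - a\<^sup>2) + (b\<^sup>2 - d\<^sup>2) * (e\<^sup>2 - c\<^sup>2)))\<^sup>2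
    = (\<Prod>k<4. heron a b d k) * (\<Prod>k<4. heron a c e k)" (is "?l = ?r")
proof -
  have "?l - ?r = - 4 * a\<^sup>2 * cm (a\<^sup>2) (b\<^sup>2) (c\<^sup>2) (d\<^sup>2) (e\<^sup>2) (f\<^sup>2)"
    unfolding cm_def by (simp add: lessThan_4 heron_def) algebra
  with assms show ?thesis by simp
qed

text \<open>The degenerate triangle occupies the argument positions \<open>A\<close>,
  \<open>C\<close>, \<open>E\<close>. Eliminating \<open>z\<close> exposes the perfect
  square.\<close>

lemma cm_collinear:
  assumes "x + y + z = 0" and "cm (x\<^sup>2) (b\<^sup>2) (z\<^sup>2) (d\<^sup>2) (y\<^sup>2) (f\<^sup>2) = 0"
  shows "x * f\<^sup>2 + y * b\<^sup>2 + z * d\<^sup>2 + x * y * z = 0"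
proof -
  have z: "z = - x - y"
    using assms(1) by algebra
  have "cm (x\<^sup>2) (b\<^sup>2) (z\<^sup>2) (d\<^sup>2) (y\<^sup>2) (f\<^sup>2) = - (x * f\<^sup>2 + y * b\<^sup>2 + z * d\<^sup>2 + x * y * z)\<^sup>2"
    unfolding cm_def z by algebra
  with assms(2) show ?thesis by simp
qed

section \<open>Linear forms on complex subspaces\<close>

text \<open>A predicate on plain functions, so that lambda terms in the edge coordinates qualify
  directly.\<close>

definition linform :: "(complex ^ 'n \<Rightarrow> complex) \<Rightarrow> bool" where
  "linform f \<longleftrightarrow> (\<forall>x y. f (x + y) = f x + f y) \<and> (\<forall>c x. f (c *s x) = c * f x)"

lemma linform_addD: "linform f \<Longrightarrow> f (x + y) = f x + f y"
  and linform_scaleD: "linform f \<Longrightarrow> f (c *s x) = c * f x"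
  by (simp_all add: linform_def)

lemma linform_zeroD: "linform f \<Longrightarrow> f 0 = 0"
  using linform_scaleD[of f 0 0] by simp

lemma linform_diffD: "linform f \<Longrightarrow> f (x - y) = f x - f y"
  using linform_addD[of f "x - y" y] by simp

lemma linform_intros:
  "linform f \<Longrightarrow> linform g \<Longrightarrow> linform (\<lambda>x. f x + g x)"
  "linform f \<Longrightarrow> linform g \<Longrightarrow> linform (\<lambda>x. f x - g x)"
  "linform f \<Longrightarrow> linform (\<lambda>x. - f x)"
  "linform f \<Longrightarrow> linform (\<lambda>x. c * f x)"
  by (simp_all add: linform_def algebra_simps)

lemma linform_el: "linform (\<lambda>x. el x i j)"
  by (simp add: linform_def el_def)

lemma linform_heron:
  "linform a \<Longrightarrow> linform b \<Longrightarrow> linform d \<Longrightarrow> linform (\<lambda>x. heron (a x) (b x) (d x) k)"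
  unfolding linform_def heron_def by (auto simp: algebra_simps)

lemma subspace_kernel:
  assumes "vec.subspace V" "linform f"
  shows "vec.subspace {x \<in> V. f x = 0}"
  using assms unfolding vec.subspace_def
  by (auto simp: linform_zeroD linform_addD linform_scaleD)

text \<open>A vector outside the kernel spans \<open>V\<close> together with the kernel, since
  subtracting a multiple of it moves any vector into the kernel.\<close>

lemma dim_le_Suc_dim_kernel:
  assumes "vec.subspace V" "linform f"
  shows "vec.dim V \<le> Suc (vec.dim {x \<in> V. f x = 0})"
proof (cases "\<forall>x\<in>V. f x = 0")
  case True
  then have "{x \<in> V. f x = 0} = V" by auto
  then show ?thesis by simp
next
  case False
  then obtain u where u: "u \<in> V" "f u \<noteq> 0" by auto
  let ?W = "{x \<in> V. f x = 0}"
  have "V \<subseteq> vec.span (insert u ?W)"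
  proof
    fix x assume x: "x \<in> V"
    let ?y = "x - (f x / f u) *s u"
    have "?y \<in> V"
      using assms(1) x u by (intro vec.subspace_diff vec.subspace_scale)
    moreover have "f ?y = 0"
      using assms(2) u by (simp add: linform_diffD linform_scaleD)
    ultimately have "?y \<in> vec.span ?W"
      by (simp add: vec.span_base)
    then show "x \<in> vec.span (insert u ?W)"
      by (auto simp: vec.span_insert)
  qed
  then have "vec.dim V \<le> vec.dim (insert u ?W)"
    by (metis vec.dim_subset vec.dim_span)
  then show ?thesis
    by (simp add: vec.dim_insert split: if_splits)
qed

text \<open>A space over an infinite field is not a finite union of proper subspaces. In the
  induction, \<open>v\<close> serves the old forms and \<open>w\<close> the new one; on the line
  through \<open>v\<close> with direction \<open>w\<close> each form rules out at most one
  parameter.\<close>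

lemma exists_avoiding_kernels:
  assumes "vec.subspace V" "finite F" "\<And>f. f \<in> F \<Longrightarrow> linform f" "\<And>f. f \<in> F \<Longrightarrow> \<exists>x\<in>V. f x \<noteq> 0"
  shows "\<exists>v\<in>V. \<forall>f\<in>F. f v \<noteq> 0"
  using assms(2-)
proof (induction F rule: finite_induct)
  case empty
  then show ?case using vec.subspace_0[OF assms(1)] by auto
next
  case (insert g F)
  then obtain v where v: "v \<in> V" "\<forall>f\<in>F. f v \<noteq> 0" by blast
  obtain w where w: "w \<in> V" "g w \<noteq> 0" using insert.prems by blast
  \<comment> \<open>If \<open>f w = 0\<close>, the quotient is \<open>0\<close> by convention, which
    excludes one more harmless value; such a form is a nonzero constant on the line.\<close>
  have "finite ((\<lambda>f. - f v / f w) ` insert g F)" using insert.hyps by simp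
  then obtain t where t: "t \<notin> (\<lambda>f. - f v / f w) ` insert g F"
    using ex_new_if_finite infinite_UNIV_char_0 by blast
  have "f (v + t *s w) \<noteq> 0" if f: "f \<in> insert g F" for f
  proof
    assume "f (v + t *s w) = 0"
    then have eq: "f v + t * f w = 0"
      using insert.prems(1)[OF f] by (simp add: linform_addD linform_scaleD)
    show False
    proof (cases "f w = 0")
      case True
      then show ?thesis using eq v w f by auto
    next
      case False
      then have "t = - f v / f w" using eq by (simp add: field_simps eq_neg_iff_add_eq_0)
      then show ?thesis using t f by blast
    qed
  qed
  moreover have "v + t *s w \<in> V"
    using assms(1) v w by (intro vec.subspace_add vec.subspace_scale)
  ultimately show ?case by blast
qed

lemma mult_linform_eq_0:
  assumes "vec.subspace V" "linform f" "linform g" "\<And>x. x \<in> V \<Longrightarrow> f x * g x = 0"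
  shows "(\<forall>x\<in>V. f x = 0) \<or> (\<forall>x\<in>V. g x = 0)"
  using exists_avoiding_kernels[OF assms(1), of "{f, g}"] assms(2-)
  by (auto; metis)

lemma mult3_linform_eq_0:
  assumes "vec.subspace V" "linform f" "linform g" "linform h" "\<And>x. x \<in> V \<Longrightarrow> f x * g x * h x = 0"
  shows "(\<forall>x\<in>V. f x = 0) \<or> (\<forall>x\<in>V. g x = 0) \<or> (\<forall>x\<in>V. h x = 0)"
proof (rule ccontr)
  assume *: "\<not> ?thesis"
  have "\<exists>v\<in>V. \<forall>k\<in>{f, g, h}. k v \<noteq> 0"
    by (rule exists_avoiding_kernels[OF assms(1)]) (use assms(2-4) * in auto)
  then show False using assms(5) by auto
qed

text \<open>A square has no simple zero. Off \<open>0\<close>, \<open>q t\<close> equals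
  \<open>g t * (g t / t)\<close>, whose first factor tends to \<open>0\<close> and whose second
  tends to the derivative.\<close>

lemma square_eq_mult_self_zero:
  fixes g q :: "complex \<Rightarrow> complex"
  assumes "g field_differentiable (at 0)" "isCont q 0" "\<And>t. (g t)\<^sup>2 = t * q t"
  shows "q 0 = 0"
proof -
  obtain g' where g': "(g has_field_derivative g') (at 0)"
    using assms(1) by (auto simp: field_differentiable_def)
  have g0: "g 0 = 0" using assms(3)[of 0] by simp
  have "((\<lambda>t. g t / t) \<longlongrightarrow> g') (at 0)"
    using g' g0 by (simp add: DERIV_def)
  moreover have "(g \<longlongrightarrow> 0) (at 0)"
    using DERIV_isCont[OF g'] g0 by (simp add: isCont_def)
  ultimately have "((\<lambda>t. g t * (g t / t)) \<longlongrightarrow> 0 * g') (at 0)"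
    by (intro tendsto_mult)
  moreover have "\<forall>\<^sub>F t in at 0. g t * (g t / t) = q t"
    using assms(3) by (auto simp: eventually_at_filter power2_eq_square field_simps)
  ultimately have "(q \<longlongrightarrow> 0) (at 0)"
    using tendsto_cong[of "\<lambda>t. g t * (g t / t)" q] by simp
  moreover have "(q \<longlongrightarrow> q 0) (at 0)"
    using assms(2) by (simp add: isCont_def)
  ultimately show ?thesis by (metis tendsto_unique trivial_limit_at)
qed

section \<open>Kernels of linear forms on a subspace of dimension at least three\<close>

locale flat =
  fixes V :: "(complex ^ 'n) set"
  assumes subspace: "vec.subspace V" and dim_ge_3: "3 \<le> vec.dim V"
begin

definition vanishes :: "(complex ^ 'n \<Rightarrow> complex) \<Rightarrow> bool" where
  "vanishes f \<longleftrightarrow> (\<forall>x\<in>V. f x = 0)"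

text \<open>For linear forms this means that \<open>f\<close> is a scalar multiple of
  \<open>g\<close> on \<open>V\<close>, the scalar \<open>0\<close> included (see
  \<open>ker_le_proportional\<close>).\<close>

definition ker_le :: "(complex ^ 'n \<Rightarrow> complex) \<Rightarrow> (complex ^ 'n \<Rightarrow> complex) \<Rightarrow> bool" where
  "ker_le g f \<longleftrightarrow> (\<forall>x\<in>V. g x = 0 \<longrightarrow> f x = 0)"

text \<open>The bound on the dimension enters the locale's arguments through this lemma: two linear
  conditions lower the dimension by at most two.\<close>

lemma exists_common_zero:
  assumes "linform f" "linform g"
  obtains v where "v \<in> V" "v \<noteq> 0" "f v = 0" "g v = 0"
proof -
  let ?U = "{x \<in> {x \<in> V. f x = 0}. g x = 0}"
  have "3 \<le> Suc (Suc (vec.dim ?U))"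
    using dim_ge_3 dim_le_Suc_dim_kernel[OF subspace assms(1)]
      dim_le_Suc_dim_kernel[OF subspace_kernel[OF subspace assms(1)] assms(2)]
    by linarith
  then have "vec.dim ?U \<noteq> 0" by linarith
  then have "\<not> ?U \<subseteq> {0}" unfolding vec.dim_eq_0 .
  then show ?thesis using that by auto
qed

lemma ker_le_proportional:
  assumes "linform g" "linform f" "ker_le g f"
  obtains c where "\<And>x. x \<in> V \<Longrightarrow> f x = c * g x"
proof (cases "vanishes g")
  case True
  then show ?thesis using that[of 0] assms(3) by (auto simp: vanishes_def ker_le_def)
next
  case False
  then obtain w where w: "w \<in> V" "g w \<noteq> 0" by (auto simp: vanishes_def)
  have "f x = (f w / g w) * g x" if x: "x \<in> V" for x
  proof -
    let ?y = "x - (g x / g w) *s w"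
    have "?y \<in> V"
      using subspace x w by (intro vec.subspace_diff vec.subspace_scale)
    moreover have "g ?y = 0"
      using assms(1) w by (simp add: linform_diffD linform_scaleD)
    ultimately have "f ?y = 0"
      using assms(3) by (simp add: ker_le_def)
    then show ?thesis
      using assms(2) by (simp add: linform_diffD linform_scaleD)
  qed
  then show ?thesis using that by blast
qed

lemma ker_le_sym:
  assumes "linform g" "linform f" "ker_le g f" "\<not> vanishes f"
  shows "ker_le f g"
proof -
  obtain c where c: "\<And>x. x \<in> V \<Longrightarrow> f x = c * g x"
    using ker_le_proportional[OF assms(1-3)] by blast
  moreover have "c \<noteq> 0" using assms(4) c by (auto simp: vanishes_def)
  ultimately show ?thesis by (auto simp: ker_le_def)
qed

lemma ker_le_trans: "ker_le f g \<Longrightarrow> ker_le g h \<Longrightarrow> ker_le f h"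
  by (simp add: ker_le_def)

text \<open>The kernel of \<open>g\<close> in \<open>V\<close> is again a subspace, so one factor of
  a product vanishing there vanishes on all of it.\<close>

lemma ker_le_mult:
  assumes "linform g" "linform f1" "linform f2"
    and "\<And>x. x \<in> V \<Longrightarrow> g x = 0 \<Longrightarrow> f1 x * f2 x = 0"
  shows "ker_le g f1 \<or> ker_le g f2"
  using mult_linform_eq_0[OF subspace_kernel[OF subspace assms(1)] assms(2,3)] assms(4)
  by (auto simp: ker_le_def)

lemma ker_le_mult3:
  assumes "linform g" "linform f1" "linform f2" "linform f3"
    and "\<And>x. x \<in> V \<Longrightarrow> g x = 0 \<Longrightarrow> f1 x * f2 x * f3 x = 0"
  shows "ker_le g f1 \<or> ker_le g f2 \<or> ker_le g f3"
  using mult3_linform_eq_0[OF subspace_kernel[OF subspace assms(1)] assms(2-4)] assms(5)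
  by (auto simp: ker_le_def)

lemma square_eq_cases:
  assumes "linform f" "linform g" "\<And>x. x \<in> V \<Longrightarrow> (f x)\<^sup>2 = (g x)\<^sup>2"
  shows "(\<forall>x\<in>V. f x = g x) \<or> (\<forall>x\<in>V. f x = - g x)"
proof -
  have "(\<forall>x\<in>V. f x - g x = 0) \<or> (\<forall>x\<in>V. f x + g x = 0)"
    by (rule mult_linform_eq_0[OF subspace])
      (use assms in \<open>auto intro: linform_intros simp: power2_eq_square algebra_simps\<close>)
  then show ?thesis by (auto simp: eq_neg_iff_add_eq_0)
qed

text \<open>A smooth quadric surface contains no plane. Where \<open>p\<close> or \<open>q\<close>
  vanishes, so does \<open>r\<close> or \<open>s\<close>. If \<open>p\<close> and \<open>q\<close>
  kill different ones, a common zero of \<open>p\<close> and \<open>q\<close> suffices. If both kill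
  \<open>r\<close>, then either \<open>r\<close> is proportional to both, or \<open>r\<close>
  vanishes and with it \<open>p\<close> or \<open>q\<close>; again two conditions suffice.\<close>

lemma hyperbolic_common_zero:
  assumes lin: "linform p" "linform q" "linform r" "linform s"
    and eq: "\<And>x. x \<in> V \<Longrightarrow> p x * q x = r x * s x"
  shows "\<exists>v\<in>V. v \<noteq> 0 \<and> p v = 0 \<and> q v = 0 \<and> r v = 0 \<and> s v = 0"
proof -
  have *: "\<exists>v\<in>V. v \<noteq> 0 \<and> p v = 0 \<and> q v = 0 \<and> r v = 0 \<and> s v = 0"
    if K: "ker_le p r" "ker_le q r" and lin': "linform r" "linform s"
      and eq': "\<And>x. x \<in> V \<Longrightarrow> p x * q x = r x * s x" for r s
  proof (cases "vanishes r")
    case True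
    then have "(\<forall>x\<in>V. p x = 0) \<or> (\<forall>x\<in>V. q x = 0)"
      using mult_linform_eq_0[OF subspace lin(1,2)] eq' by (auto simp: vanishes_def)
    then show ?thesis
      using exists_common_zero[OF lin(1) lin'(2)] exists_common_zero[OF lin(2) lin'(2)] True
      unfolding vanishes_def by metis
  next
    case False
    then have "ker_le r p" "ker_le r q"
      using K ker_le_sym lin lin' by blast+
    then show ?thesis
      using exists_common_zero[OF lin'] unfolding ker_le_def by metis
  qed
  have "ker_le p r \<or> ker_le p s" "ker_le q r \<or> ker_le q s"
    using ker_le_mult[OF lin(1,3,4)] ker_le_mult[OF lin(2,3,4)] eq by force+
  then consider "ker_le p r" "ker_le q s" | "ker_le p s" "ker_le q r"
    | "ker_le p r" "ker_le q r" | "ker_le p s" "ker_le q s" by blast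
  then show ?thesis
  proof cases
    case 1
    then show ?thesis using exists_common_zero[OF lin(1,2)] unfolding ker_le_def by metis
  next
    case 2
    then show ?thesis using exists_common_zero[OF lin(1,2)] unfolding ker_le_def by metis
  next
    case 3
    then show ?thesis using *[OF 3 lin(3,4) eq] by blast
  next
    case 4
    then show ?thesis using *[OF 4 lin(4,3)] eq by (auto simp: mult.commute)
  qed
qed

text \<open>The cubic is the Segre cubic, and the cases of the conclusion describe its 15 planes.\<close>

lemma segre_cubic_planes:
  assumes lin: "linform x" "linform y" "linform z" "linform b" "linform d" "linform f"
    and sum: "\<And>v. v \<in> V \<Longrightarrow> x v + y v + z v = 0"
    and cubic: "\<And>v. v \<in> V \<Longrightarrow> x v * (f v)\<^sup>2 + y v * (b v)\<^sup>2 + z v * (d v)\<^sup>2 + x v * y v * z v = 0"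
    and coords: "\<And>v. v \<in> V \<Longrightarrow> x v = 0 \<Longrightarrow> y v = 0 \<Longrightarrow> z v = 0 \<Longrightarrow> b v = 0 \<Longrightarrow> d v = 0 \<Longrightarrow> f v = 0 \<Longrightarrow> v = 0"
  shows "(\<forall>v\<in>V. x v = 0 \<and> y v = 0 \<and> z v = 0)
    \<or> (\<exists>s\<in>signs. \<forall>v\<in>V. x v = 0 \<and> b v = s * d v)
    \<or> (\<exists>s\<in>signs. \<forall>v\<in>V. y v = 0 \<and> f v = s * d v)
    \<or> (\<exists>s\<in>signs. \<forall>v\<in>V. z v = 0 \<and> f v = s * b v)
    \<or> (\<exists>l\<in>signs. \<exists>s\<in>signs. \<exists>t\<in>signs. \<forall>v\<in>V. b v = s * (d v + l * x v) \<and> f v = t * (d v - l * y v))"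
    (is "?C \<or> ?B1 \<or> ?B2 \<or> ?B3 \<or> ?A")
proof -
  have zv: "z v = - x v - y v" if "v \<in> V" for v
    using sum[OF that] by algebra
  have signsI: "(1::complex) \<in> signs" "(-1::complex) \<in> signs" by (simp_all add: signs_def)
  \<comment> \<open>On \<open>x = 0\<close> one has \<open>z = - y\<close>, and the cubic becomes
    \<open>y\<close> times \<open>b\<^sup>2 - d\<^sup>2\<close>. Likewise \<open>y = 0\<close>
    leaves \<open>x\<close> times \<open>f\<^sup>2 - d\<^sup>2\<close>.\<close>
  have Kx: "ker_le x y \<or> ker_le x (\<lambda>v. b v - d v) \<or> ker_le x (\<lambda>v. b v + d v)"
  proof (rule ker_le_mult3)
    fix v assume v: "v \<in> V" "x v = 0"
    show "y v * (b v - d v) * (b v + d v) = 0"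
      using cubic[OF v(1)] zv[OF v(1)] v(2) by simp algebra
  qed (intro lin linform_intros)+
  have Ky: "ker_le y x \<or> ker_le y (\<lambda>v. f v - d v) \<or> ker_le y (\<lambda>v. f v + d v)"
  proof (rule ker_le_mult3)
    fix v assume v: "v \<in> V" "y v = 0"
    show "x v * (f v - d v) * (f v + d v) = 0"
      using cubic[OF v(1)] zv[OF v(1)] v(2) by simp algebra
  qed (intro lin linform_intros)+
  have signed: "(\<exists>s\<in>signs. \<forall>v\<in>V. g v = s * h v)" if "ker_le k (\<lambda>v. g v - h v) \<or> ker_le k (\<lambda>v. g v + h v)"
    "vanishes k" for g h k
    using that unfolding ker_le_def vanishes_def signs_def by (auto simp: eq_neg_iff_add_eq_0)
  have signed': "\<exists>s\<in>signs. \<exists>c. \<forall>v\<in>V. g v = s * (h v + c * k v)"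
    if K: "ker_le k (\<lambda>v. g v - h v) \<or> ker_le k (\<lambda>v. g v + h v)"
      and L: "linform g" "linform h" "linform k" for g h k
    using K
  proof
    assume "ker_le k (\<lambda>v. g v - h v)"
    then obtain c where "\<And>v. v \<in> V \<Longrightarrow> g v - h v = c * k v"
      using ker_le_proportional[OF L(3) linform_intros(2)[OF L(1,2)]] by blast
    then have "\<forall>v\<in>V. g v = 1 * (h v + c * k v)" by (auto simp: algebra_simps)
    then show ?thesis using signsI by blast
  next
    assume "ker_le k (\<lambda>v. g v + h v)"
    then obtain c where c: "\<And>v. v \<in> V \<Longrightarrow> g v + h v = c * k v"
      using ker_le_proportional[OF L(3) linform_intros(1)[OF L(1,2)]] by blast
    have "\<forall>v\<in>V. g v = -1 * (h v + (-c) * k v)"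
    proof
      fix v assume "v \<in> V"
      from c[OF this] show "g v = -1 * (h v + (-c) * k v)" by algebra
    qed
    then show ?thesis using signsI by blast
  qed
  show ?thesis
  proof (cases "vanishes x")
    case x0: True
    show ?thesis
    proof (cases "ker_le x y")
      case True
      then have ?C using x0 zv by (auto simp: vanishes_def ker_le_def)
      then show ?thesis by blast
    next
      case False
      then have ?B1 using Kx signed[OF _ x0] x0 by (auto simp: vanishes_def)
      then show ?thesis by blast
    qed
  next
    case x0: False
    show ?thesis
    proof (cases "ker_le x y")
      case True
      then obtain \<beta> where \<beta>: "\<And>v. v \<in> V \<Longrightarrow> y v = \<beta> * x v"
        using ker_le_proportional[OF lin(1,2)] by blast
      define \<gamma> where "\<gamma> = - 1 - \<beta>"
      have \<gamma>: "z v = \<gamma> * x v" if "v \<in> V" for v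
        using zv[OF that] \<beta>[OF that] by (simp add: \<gamma>_def algebra_simps)
      obtain w where w: "w \<in> V" "x w \<noteq> 0" using x0 by (auto simp: vanishes_def)
      \<comment> \<open>With \<open>y\<close> and \<open>z\<close> multiples of \<open>x\<close>,
        the cubic is \<open>x\<close> times the quadratic form \<open>?Q\<close>.\<close>
      let ?Q = "\<lambda>v. (f v)\<^sup>2 + \<beta> * (b v)\<^sup>2 + \<gamma> * (d v)\<^sup>2 + \<beta> * \<gamma> * (x v)\<^sup>2"
      have Qx: "?Q v = 0" if "v \<in> V" "x v \<noteq> 0" for v
      proof -
        have "x v * ?Q v = 0"
          using cubic[OF that(1)] unfolding \<beta>[OF that(1)] \<gamma>[OF that(1)] by algebra
        then show ?thesis using that(2) by simp
      qed
      \<comment> \<open>The parallelogram law carries the vanishing of \<open>?Q\<close> over to the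
        kernel of \<open>x\<close>: for \<open>v\<close> there, \<open>w\<close> and
        \<open>v\<close> plus or minus \<open>w\<close> all lie outside it.\<close>
      have Q: "?Q v = 0" if v: "v \<in> V" for v
      proof (cases "x v = 0")
        case False
        then show ?thesis using Qx v by blast
      next
        case True
        have mem: "v + w \<in> V" "v - w \<in> V"
          using subspace v w by (auto intro: vec.subspace_add vec.subspace_diff)
        have nz: "x (v + w) \<noteq> 0" "x (v - w) \<noteq> 0"
          using True w lin(1) by (simp_all add: linform_addD linform_diffD)
        have "2 * ?Q v = ?Q (v + w) + ?Q (v - w) - 2 * ?Q w"
          using lin by (simp add: linform_addD linform_diffD) algebra
        also have "\<dots> = 0" using Qx[OF mem(1) nz(1)] Qx[OF mem(2) nz(2)] Qx[OF w] by simp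
        finally show ?thesis unfolding mult_eq_0_iff by simp
      qed
      consider "\<beta> = 0" | "\<gamma> = 0" | "\<beta> \<noteq> 0" "\<gamma> \<noteq> 0" by blast
      then show ?thesis
      proof cases
        case 1
        then have "\<gamma> = -1" by (simp add: \<gamma>_def)
        then have "(f v)\<^sup>2 = (d v)\<^sup>2" if "v \<in> V" for v
          using Q[OF that] 1 by simp
        from square_eq_cases[OF lin(6,5) this] have ?B2
          using \<beta> 1 by (auto simp: signs_def)
        then show ?thesis by blast
      next
        case 2
        then have "\<beta> = -1" by (simp add: \<gamma>_def eq_neg_iff_add_eq_0 add.commute)
        then have "(f v)\<^sup>2 = (b v)\<^sup>2" if "v \<in> V" for v
          using Q[OF that] 2 by simp
        from square_eq_cases[OF lin(6,4) this] have ?B3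
          using \<gamma> 2 by (auto simp: signs_def)
        then show ?thesis by blast
      next
        case 3
        \<comment> \<open>A square root of \<open>\<beta>\<close> splits \<open>?Q\<close> into two
          products of linear forms. Their common zero makes \<open>f\<close>, \<open>b\<close>,
          \<open>d\<close>, \<open>x\<close> vanish, against \<open>coords\<close>.\<close>
        define \<rho> where "\<rho> = csqrt \<beta>"
        have \<rho>: "\<rho>\<^sup>2 = \<beta>" "\<rho> \<noteq> 0" using 3 by (simp_all add: \<rho>_def)
        have "\<exists>v\<in>V. v \<noteq> 0 \<and> f v + \<i> * \<rho> * b v = 0 \<and> f v - \<i> * \<rho> * b v = 0
            \<and> - \<gamma> * (d v + \<i> * \<rho> * x v) = 0 \<and> d v - \<i> * \<rho> * x v = 0"
        proof (rule hyperbolic_common_zero)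
          fix u assume u: "u \<in> V"
          have "\<i>\<^sup>2 = -1" by simp
          then show "(f u + \<i> * \<rho> * b u) * (f u - \<i> * \<rho> * b u)
            = - \<gamma> * (d u + \<i> * \<rho> * x u) * (d u - \<i> * \<rho> * x u)"
            using Q[OF u] \<rho>(1) by algebra
        qed (intro lin linform_intros)+
        then obtain v where v: "v \<in> V" "v \<noteq> 0"
          and z: "f v + \<i> * \<rho> * b v = 0" "f v - \<i> * \<rho> * b v = 0"
            "- \<gamma> * (d v + \<i> * \<rho> * x v) = 0" "d v - \<i> * \<rho> * x v = 0"
          by blast
        have "2 * f v = 0" "2 * (\<i> * \<rho> * b v) = 0"
          using z(1,2) by algebra+
        moreover have "d v + \<i> * \<rho> * x v = 0" using z(3) 3 by simp
        then have "2 * d v = 0" "2 * (\<i> * \<rho> * x v) = 0"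
          using z(4) by algebra+
        ultimately have "f v = 0" "b v = 0" "d v = 0" "x v = 0"
          using \<rho>(2) by simp_all
        then have "v = 0" using coords \<beta> \<gamma> v by simp
        then show ?thesis using v by blast
      qed
    next
      case nK: False
      show ?thesis
      proof (cases "vanishes y")
        case y0: True
        then have "\<not> ker_le y x"
          using x0 by (auto simp: vanishes_def ker_le_def)
        then have ?B2 using Ky signed[OF _ y0] y0 by (auto simp: vanishes_def)
        then show ?thesis by blast
      next
        case y0: False
        have "\<not> ker_le y x" using nK ker_le_sym lin x0 by blast
        then obtain t \<mu> where f: "t \<in> signs" "\<forall>v\<in>V. f v = t * (d v + \<mu> * y v)"
          using Ky signed' lin by metis
        obtain s \<kappa> where b: "s \<in> signs" "\<forall>v\<in>V. b v = s * (d v + \<kappa> * x v)"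
          using nK Kx signed' lin by metis
        \<comment> \<open>Substituting the expressions for \<open>b\<close>, \<open>f\<close> and
          \<open>z\<close> turns the cubic into \<open>x\<close> times \<open>y\<close> times
          \<open>?L\<close>, so \<open>?L\<close> vanishes on \<open>V\<close>. Its coefficients are
          then read off at common zeros of \<open>x\<close>, \<open>y\<close> and of
          \<open>x\<close>, \<open>d\<close>.\<close>
        let ?L = "\<lambda>v. 2 * (\<mu> + \<kappa>) * d v + (\<mu>\<^sup>2 - 1) * y v + (\<kappa>\<^sup>2 - 1) * x v"
        have sq: "s\<^sup>2 = 1" "t\<^sup>2 = 1" using b f by (auto simp: signs_def)
        have "(\<forall>v\<in>V. x v = 0) \<or> (\<forall>v\<in>V. y v = 0) \<or> (\<forall>v\<in>V. ?L v = 0)"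
        proof (rule mult3_linform_eq_0[OF subspace])
          fix v assume v: "v \<in> V"
          then have "f v = t * (d v + \<mu> * y v)" "b v = s * (d v + \<kappa> * x v)"
            using b f by blast+
          then show "x v * y v * ?L v = 0"
            using cubic[OF v] zv[OF v] sq by algebra
        qed (intro lin linform_intros)+
        then have L: "?L v = 0" if "v \<in> V" for v
          using x0 y0 that by (auto simp: vanishes_def)
        have zero: "v = 0" if "v \<in> V" "x v = 0" "y v = 0" "d v = 0" for v
          using coords[OF that(1)] that zv[OF that(1)] b f by simp
        obtain v1 where v1: "v1 \<in> V" "v1 \<noteq> 0" "x v1 = 0" "y v1 = 0"
          using exists_common_zero[OF lin(1,2)] by blast
        then have "d v1 \<noteq> 0" "(\<mu> + \<kappa>) * d v1 = 0"
          using L[OF v1(1)] zero[OF v1(1)] by (auto simp: mult.assoc simp del: distrib_left_numeral)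
        then have "\<mu> + \<kappa> = 0" by simp
        then have \<mu>: "\<mu> = - \<kappa>" by (simp add: eq_neg_iff_add_eq_0)
        obtain v2 where "v2 \<in> V" "v2 \<noteq> 0" "x v2 = 0" "d v2 = 0"
          using exists_common_zero[OF lin(1,5)] by blast
        then have "\<mu>\<^sup>2 = 1" using L[of v2] zero[of v2] by auto
        then have "\<kappa> \<in> signs" by (simp add: \<mu> signs_def power2_eq_1_iff)
        then have ?A using b f \<mu> by (intro bexI[of _ \<kappa>] bexI[of _ s] bexI[of _ t]) auto
        then show ?thesis by blast
      qed
    qed
  qed
qed

text \<open>Call a form simple if no other one is proportional to it. If \<open>u i\<close> and
  \<open>u j\<close> are proportional, the other two forms are simple: any further proportionality
  would, by the zero sum and the nonvanishing pair sums, make all four proportional. So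
  \<open>v\<close> kills those two, hence \<open>u i + u j\<close>, which is a nonzero multiple of
  both \<open>u i\<close> and \<open>u j\<close>.\<close>

lemma four_forms_kernel:
  fixes u :: "nat \<Rightarrow> complex ^ 'n \<Rightarrow> complex"
  assumes lin: "\<And>k. linform (u k)"
    and sum: "\<And>x. (\<Sum>k<4. u k x) = 0"
    and nz: "\<And>k. k < 4 \<Longrightarrow> \<not> vanishes (u k)"
    and pair: "\<And>k m. k < 4 \<Longrightarrow> m < 4 \<Longrightarrow> k \<noteq> m \<Longrightarrow> \<not> vanishes (\<lambda>x. u k x + u m x)"
    and rank: "\<not> (\<forall>k<4. ker_le (u 0) (u k))"
    and v: "v \<in> V" "\<And>k. k < 4 \<Longrightarrow> (\<And>m. m < 4 \<Longrightarrow> m \<noteq> k \<Longrightarrow> \<not> ker_le (u k) (u m)) \<Longrightarrow> u k v = 0"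
    and "k < 4"
  shows "u k v = 0"
proof (cases "\<exists>i j. i < 4 \<and> j < 4 \<and> i \<noteq> j \<and> ker_le (u i) (u j)")
  case False
  then show ?thesis using v(2)[OF \<open>k < 4\<close>] \<open>k < 4\<close> by metis
next
  case True
  then obtain i j where ij: "i < 4" "j < 4" "i \<noteq> j" "ker_le (u i) (u j)" by blast
  obtain p q where pq: "p < 4" "q < 4" "distinct [i, j, p, q]" "{..<4} = {i, j, p, q}"
    using lessThan_4_complete_pair[OF ij(1-3)] .
  have sum4: "u i x + u j x + u p x + u q x = 0" for x
    using sum[of x] pq(3) unfolding pq(4) by (simp add: add.assoc)
  let ?s = "\<lambda>x. u i x + u j x"
  have "ker_le (u i) ?s" using ij(4) by (auto simp: ker_le_def)
  then have s: "ker_le ?s (u i)"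
    using ker_le_sym[OF lin linform_intros(1)[OF lin lin]] pair[OF ij(1-3)] by blast
  then have s': "ker_le ?s (u j)" by (auto simp: ker_le_def)
  \<comment> \<open>Proportionality is symmetric among nonvanishing forms, so any
    \<open>u i'\<close> may replace \<open>u 0\<close> in the assumption
    \<open>rank\<close>.\<close>
  have contra: False if "i' < 4" "\<And>k. k < 4 \<Longrightarrow> ker_le (u i') (u k)" for i'
  proof -
    have "ker_le (u 0) (u i')" using that ker_le_sym lin nz by (metis zero_less_numeral)
    then show False using rank that ker_le_trans by blast
  qed
  have less4: "m \<in> {i, j, p, q}" if "m < 4" for m using that pq(4) by blast
  have *: "u p' v = 0" if p': "p' < 4" "q' < 4" "distinct [i, j, p', q']" "{..<4} = {i, j, p', q'}" for p' q'
  proof (rule v(2)[OF p'(1)])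
    have sum4': "u i x + u j x + u p' x + u q' x = 0" for x
      using sum[of x] p'(3) unfolding p'(4) by (simp add: add.assoc)
    fix m assume m: "m < 4" "m \<noteq> p'"
    have mem: "n \<in> {i, j, p', q'}" if "n < 4" for n using that p'(4) by blast
    have uq': "u q' x = - u i x - u j x - u p' x" for x using sum4'[of x] by algebra
    show "\<not> ker_le (u p') (u m)"
    proof
      assume K: "ker_le (u p') (u m)"
      consider "m = i \<or> m = j" | "m = q'" using mem[OF m(1)] m(2) by blast
      then show False
      proof cases
        case 1
        have "ker_le (u j) (u i)" using ker_le_sym[OF lin lin ij(4) nz[OF ij(2)]] .
        then have Ki: "ker_le (u p') (u i)" "ker_le (u p') (u j)"
          using 1 K ij(4) ker_le_trans by blast+
        then have "ker_le (u p') (u q')" by (auto simp: ker_le_def uq')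
        then have "ker_le (u p') (u n)" if "n < 4" for n
          using mem[OF that] Ki by (auto simp: ker_le_def)
        then show False using contra p'(1) by blast
      next
        case 2
        let ?t = "\<lambda>x. u p' x + u q' x"
        have "ker_le (u p') ?t" using K 2 by (auto simp: ker_le_def)
        moreover have "\<not> vanishes ?t" using pair[of p' q'] p' by auto
        ultimately have "ker_le ?t (u p')"
          using ker_le_sym[OF lin linform_intros(1)[OF lin lin]] by blast
        moreover have "?t x = 0" if "?s x = 0" for x
          using that sum4'[of x] by algebra
        ultimately have sp: "ker_le ?s (u p')" by (simp add: ker_le_def)
        have si: "ker_le (u i) ?s" using ij(4) by (auto simp: ker_le_def)
        have "ker_le (u i) (u n)" if "n < 4" for n
          using mem[OF that] si ij(4) sp by (auto simp: ker_le_def uq')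
        then show False using contra ij(1) by blast
      qed
    qed
  qed
  have "u p v = 0" using *[OF pq] .
  moreover have "u q v = 0" using *[of q p] pq by auto
  ultimately have "?s v = 0" using sum4[of v] by simp
  then have "u i v = 0" "u j v = 0" using s s' v(1) by (auto simp: ker_le_def)
  then show ?thesis using \<open>u p v = 0\<close> \<open>u q v = 0\<close> less4[OF \<open>k < 4\<close>] by auto
qed

end

section \<open>Edge coordinates and labellings of the vertices\<close>

lemma el_commute: "el x i j = el x j i"
  by (simp add: el_def insert_commute)

text \<open>An arbitrary naming of the four vertices, so that each argument is carried out for one
  position and transferred by symmetry.\<close>

definition labelling :: "nat \<Rightarrow> nat \<Rightarrow> nat \<Rightarrow> nat \<Rightarrow> bool" where
  "labelling i j k m \<longleftrightarrow> distinct [i, j, k, m] \<and> {i, j, k, m} \<subseteq> {1..4}"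

lemma labelling_eq: "labelling i j k m \<Longrightarrow> {i, j, k, m} = {1..4}"
  unfolding labelling_def by (intro card_subset_eq) auto

lemma labelling_swap:
  assumes "labelling i j k m"
  shows "labelling i j m k"
  using assms by (auto simp: labelling_def)

lemma exhaust_6:
  fixes i :: 6
  shows "i = 1 \<or> i = 2 \<or> i = 3 \<or> i = 4 \<or> i = 5 \<or> i = 6"
proof (induct i)
  case (of_int z)
  then have "0 \<le> z" "z < 6" by simp_all
  \<comment> \<open>The representative \<open>0\<close> is the index \<open>6\<close>, since
    \<open>6 = 0\<close> in this type.\<close>
  then have "z = 0 \<or> z = 1 \<or> z = 2 \<or> z = 3 \<or> z = 4 \<or> z = 5" by arith
  then show ?case by auto
qed

lemma el_eq_0:
  assumes "labelling i j k m" "el x i j = 0" "el x i k = 0" "el x i m = 0" "el x j k = 0"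
    "el x j m = 0" "el x k m = 0"
  shows "x = 0"
proof -
  have *: "el x p q = 0" if "p \<in> {1..4}" "q \<in> {1..4}" "p \<noteq> q" for p q
  proof -
    have "p \<in> {i, j, k, m}" "q \<in> {i, j, k, m}"
      using that labelling_eq[OF assms(1)] by blast+
    then show ?thesis
      using that(3) assms(2-) by (elim insertE emptyE) (simp_all add: el_commute)
  qed
  have "x $ 1 = 0 \<and> x $ 2 = 0 \<and> x $ 3 = 0 \<and> x $ 4 = 0 \<and> x $ 5 = 0 \<and> x $ 6 = 0"
    using *[of 1 2] *[of 1 3] *[of 1 4] *[of 2 3] *[of 2 4] *[of 3 4]
    by (simp add: el_def doubleton_eq_iff)
  then show ?thesis
    unfolding vec_eq_iff using exhaust_6 by (metis zero_index)
qed

lemma L24_cm_eq_0: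
  assumes "x \<in> L24" "labelling i j k m"
  shows "cm ((el x i j)\<^sup>2) ((el x i k)\<^sup>2) ((el x i m)\<^sup>2) ((el x j k)\<^sup>2) ((el x j m)\<^sup>2) ((el x k m)\<^sup>2) = 0"
proof -
  obtain p :: "nat \<Rightarrow> nat \<Rightarrow> complex" where
    p: "\<And>i j. i \<in> {1..4} \<Longrightarrow> j \<in> {1..4} \<Longrightarrow> i < j \<Longrightarrow> (el x i j)\<^sup>2 = (\<Sum>k\<in>{1,2::nat}. (p i k - p j k)\<^sup>2)"
    using assms(1) unfolding L24_def by blast
  have "(el x i j)\<^sup>2 = (p i 1 - p j 1)\<^sup>2 + (p i 2 - p j 2)\<^sup>2"
    if "i \<in> {1..4}" "j \<in> {1..4}" "i \<noteq> j" for i j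
  proof (cases "i < j")
    case True
    then show ?thesis using p[OF that(1,2)] by simp
  next
    case False
    then show ?thesis
      using p[OF that(2,1)] that(3) by (simp add: el_commute[of x i j] power2_commute)
  qed
  then show ?thesis
    using assms(2) cm_planar unfolding labelling_def by simp
qed

locale flat_in_L24 = flat V for V :: "(complex ^ 6) set" +
  assumes subset_L24: "V \<subseteq> L24"
begin

abbreviation heron_form :: "nat \<Rightarrow> nat \<Rightarrow> nat \<Rightarrow> nat \<Rightarrow> complex ^ 6 \<Rightarrow> complex" where
  "heron_form i j k n \<equiv> \<lambda>x. heron (el x i j) (el x i k) (el x j k) n"

lemma linform_heron_form: "linform (heron_form i j k n)"
  by (intro linform_heron linform_el)

lemma cm_eq_0:
  "x \<in> V \<Longrightarrow> labelling i j k m \<Longrightarrow>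
    cm ((el x i j)\<^sup>2) ((el x i k)\<^sup>2) ((el x i m)\<^sup>2) ((el x j k)\<^sup>2) ((el x j m)\<^sup>2) ((el x k m)\<^sup>2) = 0"
  using L24_cm_eq_0 subset_L24 by blast

end

section \<open>Excluding the case without a degenerate triangle\<close>

locale flat_without_collinear = flat_in_L24 +
  assumes heron_nonvanishing: "labelling i j k m \<Longrightarrow> n < 4 \<Longrightarrow> \<not> vanishes (heron_form i j k n)"
begin

text \<open>Adding multiples of \<open>v\<close> to a generic \<open>w\<close> changes only the edge
  \<open>k m\<close>, and to any value. So \<open>cm\<close> vanishes identically as a quadratic in
  that squared edge; its coefficients give \<open>A = 0\<close> and
  \<open>(B - D) * (E - C) = 0\<close>. With \<open>A = 0\<close> both differences are products of
  two Heron factors, nonzero at \<open>w\<close>.\<close>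

lemma no_axis_vector:
  assumes lab: "labelling i j k m" and v: "v \<in> V"
    and z: "el v i j = 0" "el v i k = 0" "el v i m = 0" "el v j k = 0" "el v j m = 0"
  shows "v = 0"
proof (rule ccontr)
  assume "v \<noteq> 0"
  then have nz: "el v k m \<noteq> 0" using el_eq_0[OF lab] z by blast
  let ?F = "heron_form i j k ` {..<4} \<union> heron_form i j m ` {..<4}"
  have "\<exists>w\<in>V. \<forall>f\<in>?F. f w \<noteq> 0"
  proof (rule exists_avoiding_kernels[OF subspace])
    fix f assume "f \<in> ?F"
    then show "linform f" "\<exists>x\<in>V. f x \<noteq> 0"
      using linform_heron_form heron_nonvanishing[OF lab] heron_nonvanishing[OF labelling_swap[OF lab]]
      by (auto simp: vanishes_def)
  qed simp
  then obtain w where w: "w \<in> V" and wF: "\<forall>f\<in>?F. f w \<noteq> 0" by blast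
  have wk: "heron_form i j k n w \<noteq> 0" if "n < 4" for n
    by (rule bspec[OF wF, of "heron_form i j k n"]) (use that in simp)
  have wm: "heron_form i j m n w \<noteq> 0" if "n < 4" for n
    by (rule bspec[OF wF, of "heron_form i j m n"]) (use that in simp)
  define A B C D E where "A = (el w i j)\<^sup>2" "B = (el w i k)\<^sup>2" "C = (el w i m)\<^sup>2" "D = (el w j k)\<^sup>2" "E = (el w j m)\<^sup>2"
  note defs = this
  have cm_s: "cm A B C D E (s\<^sup>2) = 0" for s
  proof -
    define t where "t = (s - el w k m) / el v k m"
    have mem: "w + t *s v \<in> V" using subspace w v by (intro vec.subspace_add vec.subspace_scale)
    have eq: "el (w + t *s v) p q = el w p q + t * el v p q" for p q
      using linform_addD[OF linform_el] linform_scaleD[OF linform_el] by simp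
    have "el (w + t *s v) k m = s" unfolding eq using nz by (simp add: t_def)
    then show ?thesis using cm_eq_0[OF mem lab] z by (simp add: eq defs)
  qed
  \<comment> \<open>Three values determine the quadratic: four times the value at \<open>1\<close>
    minus the value at \<open>4\<close> is \<open>12 * A\<close>, given the zero at
    \<open>0\<close>.\<close>
  have "cm A B C D E 0 = 0" "cm A B C D E 1 = 0" "cm A B C D E 4 = 0"
    using cm_s[of 0] cm_s[of 1] cm_s[of 2] by simp_all
  then have A: "12 * A = 0" "(B - D) * (E - C) = 0"
    unfolding cm_def by algebra+
  then have a: "el w i j = 0" by (simp add: defs)
  have nonzero: "heron_form i j k 1 w * heron_form i j k 2 w \<noteq> 0" "heron_form i j m 1 w * heron_form i j m 2 w \<noteq> 0"
    using wk wm by simp_all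
  have eqs: "heron_form i j k 1 w * heron_form i j k 2 w = D - B" "heron_form i j m 1 w * heron_form i j m 2 w = E - C"
    using a by (simp_all add: heron_def defs power2_eq_square algebra_simps)
  show False using A(2) nonzero unfolding eqs by simp
qed

text \<open>With edge \<open>i j\<close> zero, \<open>cm\<close> restricted to \<open>b = d\<close>
  or \<open>b = - d\<close> is minus the square of \<open>b * (e\<^sup>2 - c\<^sup>2)\<close>. If
  \<open>b\<close> and \<open>d\<close> were independent, \<open>b - d\<close> and
  \<open>b + d\<close> would be proportional to \<open>e - c\<close> and \<open>e + c\<close> in
  some order, and a common zero of \<open>b\<close> and \<open>d\<close> would be an axis
  vector.\<close>

lemma edge_nonvanishing_aux:
  assumes lab: "labelling i j k m" and a: "vanishes (\<lambda>x. el x i j)"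
  shows "\<exists>g. linform g \<and> (\<forall>x\<in>V. g x = 0 \<longrightarrow> el x i k = 0 \<and> el x j k = 0)"
proof (rule ccontr)
  assume indep: "\<not> ?thesis"
  let ?b = "\<lambda>x. el x i k" and ?c = "\<lambda>x. el x i m" and ?d = "\<lambda>x. el x j k" and ?e = "\<lambda>x. el x j m"
  let ?p = "\<lambda>x. ?b x - ?d x" and ?q = "\<lambda>x. ?b x + ?d x" and ?r = "\<lambda>x. ?e x - ?c x" and ?s = "\<lambda>x. ?e x + ?c x"
  have lin: "linform ?p" "linform ?q" "linform ?r" "linform ?s" "linform ?b"
    by (intro linform_intros linform_el)+
  have nv: "\<not> vanishes ?p" "\<not> vanishes ?q" "\<not> vanishes ?r" "\<not> vanishes ?s"
    using heron_nonvanishing[OF lab, of 3] heron_nonvanishing[OF lab, of 1]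
      heron_nonvanishing[OF labelling_swap[OF lab], of 2] heron_nonvanishing[OF labelling_swap[OF lab], of 1] a
    by (auto simp: vanishes_def heron_def algebra_simps)
  have eq: "(el x k m)\<^sup>2 * ((?b x)\<^sup>2 - (?d x)\<^sup>2) * ((?e x)\<^sup>2 - (?c x)\<^sup>2)
     + ((?b x)\<^sup>2 * (?e x)\<^sup>2 - (?c x)\<^sup>2 * (?d x)\<^sup>2) * ((?c x)\<^sup>2 + (?d x)\<^sup>2 - (?b x)\<^sup>2 - (?e x)\<^sup>2) = 0" if "x \<in> V" for x
  proof -
    have "el x i j = 0" using a that by (simp add: vanishes_def)
    then show ?thesis using cm_eq_0[OF that lab] unfolding cm_def by algebra
  qed
  have pz: "?b x * ?r x * ?s x = 0" if "x \<in> V" "?p x = 0 \<or> ?q x = 0" for x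
  proof -
    have bd: "(?b x)\<^sup>2 = (?d x)\<^sup>2" using that(2) by algebra
    have "(?b x * ?r x * ?s x)\<^sup>2 = 0" using eq[OF that(1)] bd by algebra
    then show ?thesis by simp
  qed
  have Kp: "ker_le ?p ?b \<or> ker_le ?p ?r \<or> ker_le ?p ?s"
    by (rule ker_le_mult3[OF lin(1,5,3,4)]) (use pz in blast)
  have Kq: "ker_le ?q ?b \<or> ker_le ?q ?r \<or> ker_le ?q ?s"
    by (rule ker_le_mult3[OF lin(2,5,3,4)]) (use pz in blast)
  have nb: "\<not> ker_le ?p ?b" "\<not> ker_le ?q ?b"
    using indep lin(1,2) unfolding ker_le_def by force+
  have both: False if "ker_le ?p g" "ker_le ?q g" "linform g" "\<not> vanishes g" for g
  proof -
    have "ker_le g ?p" "ker_le g ?q" using that ker_le_sym lin by blast+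
    moreover have "?b x = 0 \<and> ?d x = 0" if "?p x = 0" "?q x = 0" for x
      using that by algebra
    ultimately have "\<forall>x\<in>V. g x = 0 \<longrightarrow> ?b x = 0 \<and> ?d x = 0"
      unfolding ker_le_def by blast
    then show False using indep that by blast
  qed
  have K: "ker_le ?p ?r \<and> ker_le ?q ?s \<or> ker_le ?p ?s \<and> ker_le ?q ?r"
    using Kp Kq nb both lin nv by blast
  obtain v where v: "v \<in> V" "v \<noteq> 0" "?b v = 0" "?d v = 0"
    using exists_common_zero[OF linform_el linform_el] by blast
  have "?r v = 0" "?s v = 0" using K v unfolding ker_le_def by auto
  then have "?c v = 0" "?e v = 0" by auto
  then show False using no_axis_vector[OF lab v(1)] v a by (auto simp: vanishes_def)
qed

lemma edge_nonvanishing: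
  assumes lab: "labelling i j k m"
  shows "\<not> vanishes (\<lambda>x. el x i j)"
proof
  assume a: "vanishes (\<lambda>x. el x i j)"
  obtain g h where "linform g" "linform h"
    and gh: "\<forall>x\<in>V. g x = 0 \<longrightarrow> el x i k = 0 \<and> el x j k = 0" "\<forall>x\<in>V. h x = 0 \<longrightarrow> el x i m = 0 \<and> el x j m = 0"
    using edge_nonvanishing_aux[OF lab a] edge_nonvanishing_aux[OF labelling_swap[OF lab] a] by blast
  then obtain v where "v \<in> V" "v \<noteq> 0" "g v = 0" "h v = 0"
    using exists_common_zero by blast
  then show False using no_axis_vector[OF lab, of v] gh a by (auto simp: vanishes_def)
qed

text \<open>On a line crossing the kernel of a simple Heron factor of one triangle transversally, the square
  in the discriminant identity cannot have a simple zero.\<close>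

lemma simple_heron_form_shared:
  assumes lab: "labelling i j k m" and n: "n < 4"
    and simple: "\<And>n'. n' < 4 \<Longrightarrow> n' \<noteq> n \<Longrightarrow> \<not> ker_le (heron_form i j k n) (heron_form i j k n')"
  shows "\<exists>n'<4. ker_le (heron_form i j k n) (heron_form i j m n')"
proof (rule ccontr)
  assume none: "\<not> ?thesis"
  let ?u = "heron_form i j k" and ?u' = "heron_form i j m"
  \<comment> \<open>The point \<open>v\<close> is generic in the kernel of factor \<open>n\<close>:
    the seven other factors of both triangles are nonzero there.\<close>
  let ?F = "?u ` ({..<4} - {n}) \<union> ?u' ` {..<4}"
  have "\<exists>v\<in>{x \<in> V. ?u n x = 0}. \<forall>f\<in>?F. f v \<noteq> 0"
  proof (rule exists_avoiding_kernels[OF subspace_kernel[OF subspace linform_heron_form]])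
    fix f assume "f \<in> ?F"
    then consider n' where "n' < 4" "n' \<noteq> n" "f = ?u n'" | n' where "n' < 4" "f = ?u' n'" by blast
    then show "linform f" "\<exists>x\<in>{x \<in> V. ?u n x = 0}. f x \<noteq> 0"
      by (cases; use linform_heron_form none simple in \<open>force simp: ker_le_def\<close>)+
  qed simp
  then obtain v where v: "v \<in> V" "?u n v = 0" and vF: "\<forall>f\<in>?F. f v \<noteq> 0" by blast
  have vk: "?u n' v \<noteq> 0" if "n' < 4" "n' \<noteq> n" for n'
    by (rule bspec[OF vF, of "?u n'"]) (use that in simp)
  have vm: "?u' n' v \<noteq> 0" if "n' < 4" for n'
    by (rule bspec[OF vF, of "?u' n'"]) (use that in simp)
  obtain w where w: "w \<in> V" "?u n w \<noteq> 0"
    using heron_nonvanishing[OF lab n] by (auto simp: vanishes_def)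
  define l where "l p q t = el v p q + t * el w p q" for p q t
  have l: "el (v + t *s w) p q = l p q t" for p q t
    using linform_addD[OF linform_el] linform_scaleD[OF linform_el] by (simp add: l_def)
  define g where "g t = 2 * (l i j t)\<^sup>2 * (l k m t)\<^sup>2 - ((l i j t)\<^sup>2 * ((l i k t)\<^sup>2 + (l i m t)\<^sup>2
      + (l j k t)\<^sup>2 + (l j m t)\<^sup>2 - (l i j t)\<^sup>2) + ((l i k t)\<^sup>2 - (l j k t)\<^sup>2) * ((l j m t)\<^sup>2 - (l i m t)\<^sup>2))" for t
  \<comment> \<open>The discriminant along the line, divided by the simple zero \<open>t\<close>
    contributed by factor \<open>n\<close>.\<close>
  define q where "q t = ?u n w * (\<Prod>n'\<in>{..<4} - {n}. ?u n' v + t * ?u n' w) * (\<Prod>n'<4. ?u' n' v + t * ?u' n' w)" for t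
  have hl: "heron_form p r s n' (v + t *s w) = heron_form p r s n' v + t * heron_form p r s n' w" for p r s n' t
    using linform_addD[OF linform_heron_form] linform_scaleD[OF linform_heron_form] by simp
  have "q 0 = 0"
  proof (rule square_eq_mult_self_zero)
    show "g field_differentiable at 0"
      unfolding g_def l_def by (intro derivative_intros)
    show "isCont q 0"
      unfolding q_def by (intro continuous_intros)
    fix t
    have mem: "v + t *s w \<in> V" using subspace w v by (intro vec.subspace_add vec.subspace_scale)
    have "(g t)\<^sup>2 = (\<Prod>n'<4. ?u n' (v + t *s w)) * (\<Prod>n'<4. ?u' n' (v + t *s w))"
      unfolding g_def l[symmetric] by (rule cm_discriminant[OF cm_eq_0[OF mem lab]])
    also have "(\<Prod>n'<4. ?u n' (v + t *s w)) = (t * ?u n w) * (\<Prod>n'\<in>{..<4} - {n}. ?u n' v + t * ?u n' w)"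
      using n v(2) unfolding hl by (subst prod.remove[of _ n]) auto
    also have "\<dots> * (\<Prod>n'<4. ?u' n' (v + t *s w)) = t * q t"
      unfolding hl q_def by (simp only: mult.assoc)
    finally show "(g t)\<^sup>2 = t * q t" .
  qed
  then show False using vk vm w by (auto simp: q_def)
qed

definition kills :: "nat \<Rightarrow> nat \<Rightarrow> nat \<Rightarrow> complex ^ 6 \<Rightarrow> bool" where
  "kills i j k x \<longleftrightarrow> el x i j = 0 \<and> el x i k = 0 \<and> el x j k = 0"

text \<open>Restricted to \<open>V\<close>, the three edges are multiples of one linear
  form.\<close>

definition rank_le_1 :: "nat \<Rightarrow> nat \<Rightarrow> nat \<Rightarrow> bool" where
  "rank_le_1 i j k \<longleftrightarrow> (\<exists>g. linform g \<and> (\<forall>x\<in>V. g x = 0 \<longrightarrow> kills i j k x))"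

lemma kills_iff_heron: "kills i j k x \<longleftrightarrow> (\<forall>n<4. heron_form i j k n x = 0)"
  unfolding heron_eq_0_iff kills_def ..

lemma heron_pair_nonvanishing:
  assumes lab: "labelling i j k m" and "n < 4" "n' < 4" "n \<noteq> n'"
  shows "\<not> vanishes (\<lambda>x. heron_form i j k n x + heron_form i j k n' x)"
proof -
  have "labelling i k j m" "labelling j k i m"
    using lab by (auto simp: labelling_def)
  then have "\<not> vanishes (\<lambda>x. el x i j)" "\<not> vanishes (\<lambda>x. el x i k)" "\<not> vanishes (\<lambda>x. el x j k)"
    using lab edge_nonvanishing by blast+
  moreover obtain s :: complex where "s = 2 \<or> s = - 2"
    "(\<forall>a b d. heron a b d n + heron a b d n' = s * a) \<or> (\<forall>a b d. heron a b d n + heron a b d n' = s * b)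
      \<or> (\<forall>a b d. heron a b d n + heron a b d n' = s * d)"
    using heron_pair_sum assms(2-) by blast
  ultimately show ?thesis by (auto simp: vanishes_def)
qed

text \<open>Each simple Heron factor of \<open>i j k\<close> is proportional to a factor of
  \<open>i j m\<close> and so vanishes at \<open>v\<close>; \<open>four_forms_kernel\<close> extends
  this to the remaining factors.\<close>

lemma kills_other:
  assumes lab: "labelling i j k m" and rank: "\<not> rank_le_1 i j k" and v: "v \<in> V" "kills i j m v"
  shows "kills i j k v"
  unfolding kills_iff_heron
proof (intro allI impI)
  fix n :: nat assume "n < 4"
  show "heron_form i j k n v = 0"
  proof (rule four_forms_kernel[of "heron_form i j k"])
    show "\<not> (\<forall>n<4. ker_le (heron_form i j k 0) (heron_form i j k n))"
      using rank linform_heron_form unfolding rank_le_1_def kills_iff_heron ker_le_def by blast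
    fix n :: nat assume n: "n < 4"
      and simple: "\<And>n'. n' < 4 \<Longrightarrow> n' \<noteq> n \<Longrightarrow> \<not> ker_le (heron_form i j k n) (heron_form i j k n')"
    obtain n' where n': "n' < 4" "ker_le (heron_form i j k n) (heron_form i j m n')"
      using simple_heron_form_shared[OF lab n simple] by blast
    have "ker_le (heron_form i j m n') (heron_form i j k n)"
      using ker_le_sym[OF linform_heron_form linform_heron_form n'(2)]
        heron_nonvanishing[OF labelling_swap[OF lab] n'(1)] by blast
    then show "heron_form i j k n v = 0"
      using v n' unfolding ker_le_def kills_iff_heron by blast
  qed (use lab v \<open>n < 4\<close> in \<open>simp_all add: linform_heron_form heron_sum heron_nonvanishing heron_pair_nonvanishing\<close>)
qed

lemma not_rank_le_1:
  assumes lab: "labelling i j k m"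
  shows "\<not> rank_le_1 i j k"
proof
  assume 1: "rank_le_1 i j k"
  \<comment> \<open>Otherwise \<open>kills_other\<close> would let the form for \<open>i j k\<close>
    serve for \<open>i j m\<close> as well.\<close>
  then have 2: "rank_le_1 i j m"
    using kills_other[OF labelling_swap[OF lab]] unfolding rank_le_1_def by blast
  obtain g h where "linform g" "linform h"
    and gh: "\<forall>x\<in>V. g x = 0 \<longrightarrow> kills i j k x" "\<forall>x\<in>V. h x = 0 \<longrightarrow> kills i j m x"
    using 1 2 unfolding rank_le_1_def by blast
  then obtain v where "v \<in> V" "v \<noteq> 0" "g v = 0" "h v = 0"
    using exists_common_zero by blast
  then show False using no_axis_vector[OF lab, of v] gh by (auto simp: kills_def)
qed

text \<open>Both triangles at edge \<open>i j\<close> are killed, which leaves only an axis vector.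
  Hence the edges of any one triangle are injective coordinates on \<open>V\<close>.\<close>

lemma kills_eq_0:
  assumes lab: "labelling i j k m" and v: "v \<in> V" "kills i j k v"
  shows "v = 0"
proof -
  have lab': "labelling i j m k" using lab by (auto simp: labelling_def)
  have "kills i j m v"
    using kills_other[OF lab' not_rank_le_1[OF lab'] v] .
  then show ?thesis using no_axis_vector[OF lab v(1)] v(2) by (auto simp: kills_def)
qed

text \<open>A common zero of factor \<open>n\<close> and a third factor would also kill
  \<open>n'\<close> and, by the zero sum, the fourth, hence the whole triangle.\<close>

lemma heron_forms_independent:
  assumes lab: "labelling i j k m" and "n < 4" "n' < 4" "n \<noteq> n'"
  shows "\<not> ker_le (heron_form i j k n) (heron_form i j k n')"
proof
  assume K: "ker_le (heron_form i j k n) (heron_form i j k n')"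
  obtain r q where rq: "r < 4" "q < 4" "distinct [n, n', r, q]" "{..<4} = {n, n', r, q}"
    using lessThan_4_complete_pair[OF assms(2-)] .
  obtain v where v: "v \<in> V" "v \<noteq> 0" "heron_form i j k n v = 0" "heron_form i j k r v = 0"
    using exists_common_zero[OF linform_heron_form linform_heron_form] by blast
  have n': "heron_form i j k n' v = 0" using K v by (auto simp: ker_le_def)
  moreover have "heron_form i j k q v = 0"
    using heron_sum[of "el v i j" "el v i k" "el v j k"] v(3,4) n' rq(3) unfolding rq(4) by auto
  ultimately have "\<forall>n\<in>{..<4}. heron_form i j k n v = 0"
    using v(3,4) unfolding rq(4) by blast
  then have "kills i j k v" unfolding kills_iff_heron by blast
  then show False using kills_eq_0[OF lab] v by blast
qed

text \<open>The Heron factors of two triangles agree up to a common scalar, as the relation that they sum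
  to zero is the only one, and the scalar is a sign because of the common edge.\<close>

lemma opposite_squares:
  assumes lab: "labelling i j k m" and v: "v \<in> V"
  shows "(el v i k)\<^sup>2 + (el v j k)\<^sup>2 = (el v i m)\<^sup>2 + (el v j m)\<^sup>2"
proof -
  let ?u = "heron_form i j k" and ?u' = "heron_form i j m"
  have lab': "labelling i j m k" using lab by (auto simp: labelling_def)
  have "\<exists>n'<4. ker_le (?u n) (?u' n')" if "n < 4" for n
    by (rule simple_heron_form_shared[OF lab that], rule heron_forms_independent[OF lab that]) auto
  then have "\<forall>n\<in>{..<4}. \<exists>n'. n' < 4 \<and> ker_le (?u n) (?u' n')" by simp
  from bchoice[OF this] obtain \<phi> where
    \<phi>': "\<forall>n\<in>{..<4}. \<phi> n < 4 \<and> ker_le (?u n) (?u' (\<phi> n))" by blast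
  have \<phi>: "\<phi> n < 4" "ker_le (?u n) (?u' (\<phi> n))" if "n < 4" for n
    using \<phi>' that by simp_all
  have "inj_on \<phi> {..<4}"
  proof (rule inj_onI, rule ccontr)
    fix n n' assume *: "n \<in> {..<4}" "n' \<in> {..<4}" "\<phi> n = \<phi> n'" "n \<noteq> n'"
    then have n: "n < 4" "n' < 4" by simp_all
    have "ker_le (?u' (\<phi> n')) (?u n')"
      by (rule ker_le_sym[OF linform_heron_form linform_heron_form \<phi>(2)[OF n(2)] heron_nonvanishing[OF lab' \<phi>(1)[OF n(2)]]])
    then have "ker_le (?u n) (?u n')" by (rule ker_le_trans[OF \<phi>(2)[OF n(1), unfolded *(3)]])
    then show False using heron_forms_independent[OF lab n *(4)] by contradiction
  qed
  moreover have "\<phi> ` {..<4} \<subseteq> {..<4}" using \<phi> by auto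
  ultimately have bij: "bij_betw \<phi> {..<4} {..<4}"
    by (simp add: bij_betw_def endo_inj_surj)
  have "\<exists>c. \<forall>x\<in>V. ?u' (\<phi> n) x = c * ?u n x" if "n < 4" for n
    by (rule ker_le_proportional[OF linform_heron_form linform_heron_form \<phi>(2)[OF that]]) blast
  then have "\<forall>n\<in>{..<4}. \<exists>c. \<forall>x\<in>V. ?u' (\<phi> n) x = c * ?u n x" by simp
  from bchoice[OF this] obtain \<mu> where
    \<mu>': "\<forall>n\<in>{..<4}. \<forall>x\<in>V. ?u' (\<phi> n) x = \<mu> n * ?u n x" by blast
  have \<mu>: "?u' (\<phi> n) x = \<mu> n * ?u n x" if "n < 4" "x \<in> V" for n x
    using \<mu>' that by simp
  have rel: "(\<Sum>n<4. \<mu> n * ?u n x) = 0" if "x \<in> V" for x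
  proof -
    have "(\<Sum>n<4. \<mu> n * ?u n x) = (\<Sum>n<4. ?u' (\<phi> n) x)" using \<mu> that by simp
    also have "\<dots> = (\<Sum>n<4. ?u' n x)" by (rule sum.reindex_bij_betw[OF bij])
    finally show ?thesis by (simp add: heron_sum)
  qed
  \<comment> \<open>At a common zero of the other two factors, \<open>rel\<close> and the zero sum
    both relate the factors \<open>0\<close> and \<open>n\<close>; comparing them equates the
    scalars.\<close>
  have \<mu>eq: "\<mu> n = \<mu> 0" if n: "n < 4" for n
  proof (cases "n = 0")
    case False
    then have "0 \<noteq> n" by simp
    then obtain p q where pq: "distinct [0, n, p, q]" "{..<4} = {0, n, p, q}"
      using lessThan_4_complete_pair[OF zero_less_numeral n] by blast
    obtain x where x: "x \<in> V" "x \<noteq> 0" "?u p x = 0" "?u q x = 0"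
      using exists_common_zero[OF linform_heron_form linform_heron_form] by blast
    have "\<mu> 0 * ?u 0 x + \<mu> n * ?u n x = 0"
      using rel[OF x(1)] x(3,4) pq(1) unfolding pq(2) by auto
    moreover have s: "?u 0 x + ?u n x = 0"
      using heron_sum[of "el x i j" "el x i k" "el x j k"] x(3,4) pq(1) unfolding pq(2) by auto
    ultimately have "(\<mu> n - \<mu> 0) * ?u n x = 0" by algebra
    moreover have "?u n x \<noteq> 0"
    proof
      assume "?u n x = 0"
      then have "\<forall>n\<in>{0, n, p, q}. ?u n x = 0" using s x(3,4) by auto
      then have "kills i j k x" unfolding kills_iff_heron pq(2)[symmetric] by auto
      then show False using kills_eq_0[OF lab] x by blast
    qed
    ultimately show ?thesis by simp
  qed simp
  define \<nu> where "\<nu> = \<mu> 0"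
  have \<nu>: "?u' (\<phi> n) x = \<nu> * ?u n x" if "n < 4" "x \<in> V" for n x
    using \<mu>[OF that] \<mu>eq[OF that(1)] by (simp add: \<nu>_def)
  \<comment> \<open>The factors 0 and 1 of \<open>i j m\<close> add up to -2 times the common edge.
    The matching pair for \<open>i j k\<close> gives plus or minus twice some edge, which must be
    \<open>i j\<close>, as seen where the other two edges vanish.\<close>
  have "\<nu>\<^sup>2 = 1"
  proof -
    have "0 \<in> \<phi> ` {..<4}" "1 \<in> \<phi> ` {..<4}" using bij by (auto simp: bij_betw_def)
    then obtain n n' where n: "n < 4" "n' < 4" "\<phi> n = 0" "\<phi> n' = 1" by force
    then have "n \<noteq> n'" by auto
    obtain s :: complex where s: "s = 2 \<or> s = - 2" and
      alt: "(\<forall>a b d. heron a b d n + heron a b d n' = s * a) \<or> (\<forall>a b d. heron a b d n + heron a b d n' = s * b)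
      \<or> (\<forall>a b d. heron a b d n + heron a b d n' = s * d)"
      using heron_pair_sum[OF n(1,2) \<open>n \<noteq> n'\<close>] by blast
    have eq: "- 2 * el x i j = \<nu> * (?u n x + ?u n' x)" if "x \<in> V" for x
    proof -
      have "- 2 * el x i j = ?u' 0 x + ?u' 1 x" by (simp add: heron_def)
      also have "\<dots> = \<nu> * (?u n x + ?u n' x)"
        using \<nu>[OF n(1) that] \<nu>[OF n(2) that] n by (simp add: algebra_simps)
      finally show ?thesis .
    qed
    obtain x where x: "x \<in> V" "x \<noteq> 0" "el x i k = 0" "el x j k = 0"
      using exists_common_zero[OF linform_el linform_el] by blast
    then have a: "el x i j \<noteq> 0" using kills_eq_0[OF lab] by (auto simp: kills_def)
    have "- 2 * el x i j = \<nu> * s * el x i j"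
      using alt eq[OF x(1)] x a by auto
    then have "(\<nu> * s + 2) * el x i j = 0" by algebra
    then have "\<nu> * s + 2 = 0" using a by simp
    moreover have "s\<^sup>2 = 4" using s by auto
    ultimately have "4 * \<nu>\<^sup>2 = 4" by algebra
    then show ?thesis by simp
  qed
  have "4 * ((el v i j)\<^sup>2 + (el v i m)\<^sup>2 + (el v j m)\<^sup>2) = (\<Sum>n<4. (?u' n v)\<^sup>2)"
    by (simp only: heron_sum_squares)
  also have "\<dots> = (\<Sum>n<4. (?u' (\<phi> n) v)\<^sup>2)"
    by (rule sum.reindex_bij_betw[OF bij, symmetric])
  also have "\<dots> = (\<Sum>n<4. (?u n v)\<^sup>2)"
    using \<nu> v \<open>\<nu>\<^sup>2 = 1\<close> by (simp add: power_mult_distrib)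
  also have "\<dots> = 4 * ((el v i j)\<^sup>2 + (el v i k)\<^sup>2 + (el v j k)\<^sup>2)"
    by (simp only: heron_sum_squares)
  finally show ?thesis by algebra
qed

text \<open>Where the edges 13 and 23 vanish, the three relations make 14 and 24 vanish too and
  equate the squares of 12 and 34. There \<open>cm\<close> is -2 times the sixth power of edge 12,
  which is nonzero by \<open>kills_eq_0\<close>.\<close>

lemma contradiction: False
proof -
  have lab: "labelling 1 2 3 4" "labelling 1 3 2 4" "labelling 2 3 1 4" by (auto simp: labelling_def)
  obtain v where v: "v \<in> V" "v \<noteq> 0" "el v 1 3 = 0" "el v 2 3 = 0"
    using exists_common_zero[OF linform_el linform_el] by blast
  have "el v 1 2 \<noteq> 0" using kills_eq_0[OF lab(1) v(1)] v by (auto simp: kills_def)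
  moreover have "(el v 1 2)^6 = 0"
    using opposite_squares[OF lab(1) v(1)] opposite_squares[OF lab(2) v(1)] opposite_squares[OF lab(3) v(1)]
      cm_eq_0[OF v(1) lab(1)] v(3,4)
    unfolding cm_def el_commute[of v 3 2] el_commute[of v 2 1] el_commute[of v 3 1] by algebra
  ultimately show False by simp
qed

end

section \<open>From a degenerate triangle to a component of the singular locus\<close>

lemma signs_mult: "s \<in> signs \<Longrightarrow> t \<in> signs \<Longrightarrow> s * t \<in> signs"
  by (auto simp: signs_def)

lemma signs_uminus: "s \<in> signs \<Longrightarrow> - s \<in> signs"
  by (auto simp: signs_def)

lemma signs_square: "s \<in> signs \<Longrightarrow> s * s = 1"
  by (auto simp: signs_def)

lemma heron_signs:
  "\<exists>s\<in>signs. \<exists>t\<in>signs. \<exists>r\<in>signs. \<forall>a b d. heron a b d n = s * a + t * b + r * d"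
  by (cases "n = 0"; cases "n = 1"; cases "n = 2") (simp_all add: signs_def heron_def)

text \<open>The function \<open>p\<close> places the vertices on a line. Multiplying all signs by
  that of edge 12 gives it coefficient 1, as in \<open>singA\<close>; the equations then say that
  differences add up around triangles.\<close>

lemma subset_singA:
  assumes "\<And>i j. i \<in> {1..4} \<Longrightarrow> j \<in> {1..4} \<Longrightarrow> i \<noteq> j \<Longrightarrow> \<exists>s\<in>signs. \<forall>x\<in>V. el x i j = s * (p i x - p j x)"
  shows "\<exists>S\<in>sing_components. V \<subseteq> S"
proof -
  obtain e12 where e12: "e12 \<in> signs" "\<forall>x\<in>V. el x 1 2 = e12 * (p 1 x - p 2 x)" using assms[of 1 2] by auto
  obtain e13 where e13: "e13 \<in> signs" "\<forall>x\<in>V. el x 1 3 = e13 * (p 1 x - p 3 x)" using assms[of 1 3] by auto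
  obtain e14 where e14: "e14 \<in> signs" "\<forall>x\<in>V. el x 1 4 = e14 * (p 1 x - p 4 x)" using assms[of 1 4] by auto
  obtain e23 where e23: "e23 \<in> signs" "\<forall>x\<in>V. el x 2 3 = e23 * (p 2 x - p 3 x)" using assms[of 2 3] by auto
  obtain e24 where e24: "e24 \<in> signs" "\<forall>x\<in>V. el x 2 4 = e24 * (p 2 x - p 4 x)" using assms[of 2 4] by auto
  obtain e34 where e34: "e34 \<in> signs" "\<forall>x\<in>V. el x 3 4 = e34 * (p 3 x - p 4 x)" using assms[of 3 4] by auto
  note sq = signs_square[OF e13(1)] signs_square[OF e14(1)] signs_square[OF e23(1)] signs_square[OF e24(1)] signs_square[OF e34(1)]
  have "V \<subseteq> singA (e12 * e13) (e12 * e14) (e12 * e23) (e12 * e24) (e12 * e34)"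
  proof
    fix x assume "x \<in> V"
    then have "el x 1 2 = e12 * (p 1 x - p 2 x)" "el x 1 3 = e13 * (p 1 x - p 3 x)" "el x 1 4 = e14 * (p 1 x - p 4 x)"
      "el x 2 3 = e23 * (p 2 x - p 3 x)" "el x 2 4 = e24 * (p 2 x - p 4 x)" "el x 3 4 = e34 * (p 3 x - p 4 x)"
      using e12 e13 e14 e23 e24 e34 by blast+
    then show "x \<in> singA (e12 * e13) (e12 * e14) (e12 * e23) (e12 * e24) (e12 * e34)"
      unfolding singA_def mem_Collect_eq using sq by (intro conjI; algebra)
  qed
  moreover have "singA (e12 * e13) (e12 * e14) (e12 * e23) (e12 * e24) (e12 * e34) \<in> sing_components"
    unfolding sing_components_def
    using signs_mult[OF e12(1) e13(1)] signs_mult[OF e12(1) e14(1)] signs_mult[OF e12(1) e23(1)]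
      signs_mult[OF e12(1) e24(1)] signs_mult[OF e12(1) e34(1)] by blast
  ultimately show ?thesis by blast
qed

lemma singB_in_sing_components:
  assumes "labelling a b c e" "s \<in> signs" "t \<in> signs"
  shows "singB a b c e s t \<in> sing_components"
proof -
  have "distinct [a, b, c, e]" "{a, b, c, e} = {1..4}"
    using assms(1) labelling_eq[OF assms(1)] by (simp_all only: labelling_def)
  then show ?thesis unfolding sing_components_def using assms(2,3) by blast
qed

lemma singC_in_sing_components:
  assumes "labelling a b c e"
  shows "singC a b c \<in> sing_components"
proof -
  have "distinct [a, b, c]" "{a, b, c} \<subseteq> {1..4}"
    using assms by (auto simp: labelling_def)
  then show ?thesis unfolding sing_components_def by blast
qed

context flat_in_L24
begin

lemma collinear_triangle:
  obtains i j k m n where "labelling i j k m" "vanishes (heron_form i j k n)"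
proof (rule ccontr)
  assume "\<not> thesis"
  then interpret flat_without_collinear V
    using that by unfold_locales blast
  show False by (rule contradiction)
qed

lemma subset_component: "\<exists>S\<in>sing_components. V \<subseteq> S"
proof -
  obtain i j k m n where lab: "labelling i j k m" and van: "vanishes (heron_form i j k n)"
    by (rule collinear_triangle)
  obtain s1 s2 s3 where s: "s1 \<in> signs" "s2 \<in> signs" "s3 \<in> signs"
    and heron: "\<forall>a b d. heron a b d n = s1 * a + s2 * b + s3 * d"
    using heron_signs[of n] by blast
  have sq: "s1 * s1 = 1" "s2 * s2 = 1" "s3 * s3 = 1" using s signs_square by blast+
  then have nz: "s1 \<noteq> 0" "s2 \<noteq> 0" "s3 \<noteq> 0" by auto
  have sum: "s1 * el v i j + s3 * el v j k + s2 * el v i k = 0" if "v \<in> V" for v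
    using van that heron by (simp add: vanishes_def algebra_simps)
  \<comment> \<open>Exchanging the last two vertices puts the degenerate triangle into the positions
    expected by \<open>cm_collinear\<close>.\<close>
  have lab': "labelling i j m k" using lab by (rule labelling_swap)
  let ?x = "\<lambda>v. s1 * el v i j" and ?y = "\<lambda>v. s3 * el v j k" and ?z = "\<lambda>v. s2 * el v i k"
  have "(\<forall>v\<in>V. ?x v = 0 \<and> ?y v = 0 \<and> ?z v = 0)
    \<or> (\<exists>s\<in>signs. \<forall>v\<in>V. ?x v = 0 \<and> el v i m = s * el v j m)
    \<or> (\<exists>s\<in>signs. \<forall>v\<in>V. ?y v = 0 \<and> el v m k = s * el v j m)
    \<or> (\<exists>s\<in>signs. \<forall>v\<in>V. ?z v = 0 \<and> el v m k = s * el v i m)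
    \<or> (\<exists>l\<in>signs. \<exists>s\<in>signs. \<exists>t\<in>signs. \<forall>v\<in>V. el v i m = s * (el v j m + l * ?x v) \<and> el v m k = t * (el v j m - l * ?y v))"
  proof (rule segre_cubic_planes)
    fix v assume v: "v \<in> V"
    show "?x v + ?y v + ?z v = 0" by (rule sum[OF v])
    have "cm ((?x v)\<^sup>2) ((el v i m)\<^sup>2) ((?z v)\<^sup>2) ((el v j m)\<^sup>2) ((?y v)\<^sup>2) ((el v m k)\<^sup>2) = 0"
      using cm_eq_0[OF v lab'] sq[folded power2_eq_square] by (simp add: power_mult_distrib)
    then show "?x v * (el v m k)\<^sup>2 + ?y v * (el v i m)\<^sup>2 + ?z v * (el v j m)\<^sup>2 + ?x v * ?y v * ?z v = 0"
      by (rule cm_collinear[OF sum[OF v]])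
    assume "?x v = 0" "?y v = 0" "?z v = 0" "el v i m = 0" "el v j m = 0" "el v m k = 0"
    then show "v = 0" using el_eq_0[OF lab'] nz by simp
  qed (intro linform_intros linform_el)+
  then consider (C) "\<forall>v\<in>V. ?x v = 0 \<and> ?y v = 0 \<and> ?z v = 0"
    | (B1) s where "s \<in> signs" "\<forall>v\<in>V. ?x v = 0 \<and> el v i m = s * el v j m"
    | (B2) s where "s \<in> signs" "\<forall>v\<in>V. ?y v = 0 \<and> el v m k = s * el v j m"
    | (B3) s where "s \<in> signs" "\<forall>v\<in>V. ?z v = 0 \<and> el v m k = s * el v i m"
    | (A) l s t where "l \<in> signs" "s \<in> signs" "t \<in> signs"
      "\<forall>v\<in>V. el v i m = s * (el v j m + l * ?x v) \<and> el v m k = t * (el v j m - l * ?y v)"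
    by blast
  then show ?thesis
  proof cases
    case C
    then have "V \<subseteq> singC i j k" using nz by (auto simp: singC_def)
    moreover have "singC i j k \<in> sing_components"
      using singC_in_sing_components[OF lab] .
    ultimately show ?thesis by blast
  next
    case (B1 s)
    have "V \<subseteq> singB i j k m (- (s2 * s3)) s"
    proof
      fix v assume v: "v \<in> V"
      have "el v i j = 0" using B1 v nz by simp
      moreover have "el v i k = - (s2 * s3) * el v j k"
        using sum[OF v] sq \<open>el v i j = 0\<close> by algebra
      ultimately show "v \<in> singB i j k m (- (s2 * s3)) s"
        using B1 v by (simp add: singB_def)
    qed
    then show ?thesis
      using singB_in_sing_components[OF lab signs_uminus[OF signs_mult[OF s(2,3)]] B1(1)] by blast
  next
    case (B2 s)
    have "V \<subseteq> singB j k i m (- (s1 * s2)) s"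
    proof
      fix v assume v: "v \<in> V"
      have "el v j k = 0" using B2 v nz by simp
      moreover have "el v j i = - (s1 * s2) * el v k i"
        using sum[OF v] sq \<open>el v j k = 0\<close> unfolding el_commute[of v j i] el_commute[of v k i] by algebra
      moreover have "el v j m = s * el v k m"
        using B2 v signs_square[OF B2(1)] unfolding el_commute[of v k m] by (simp add: mult.assoc[symmetric])
      ultimately show "v \<in> singB j k i m (- (s1 * s2)) s"
        by (simp add: singB_def)
    qed
    moreover have "labelling j k i m" using lab by (auto simp: labelling_def)
    ultimately show ?thesis
      using singB_in_sing_components[OF _ signs_uminus[OF signs_mult[OF s(1,2)]] B2(1)] by blast
  next
    case (B3 s)
    have "V \<subseteq> singB i k j m (- (s1 * s3)) s"
    proof
      fix v assume v: "v \<in> V"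
      have "el v i k = 0" using B3 v nz by simp
      moreover have "el v i j = - (s1 * s3) * el v k j"
        using sum[OF v] sq \<open>el v i k = 0\<close> unfolding el_commute[of v k j] by algebra
      moreover have "el v i m = s * el v k m"
        using B3 v signs_square[OF B3(1)] unfolding el_commute[of v k m] by (simp add: mult.assoc[symmetric])
      ultimately show "v \<in> singB i k j m (- (s1 * s3)) s"
        by (simp add: singB_def)
    qed
    moreover have "labelling i k j m" using lab by (auto simp: labelling_def)
    ultimately show ?thesis
      using singB_in_sing_components[OF _ signs_uminus[OF signs_mult[OF s(1,3)]] B3(1)] by blast
  next
    case (A l s t)
    \<comment> \<open>Positions on a line with \<open>j\<close> at the origin; the signs
      \<open>s1\<close>, \<open>s3\<close> and \<open>l\<close> orient the edges from
      \<open>j\<close> to \<open>i\<close>, \<open>k\<close> and \<open>m\<close>.\<close>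
    define p where "p q v = (if q = i then ?x v else if q = j then 0 else if q = k then - ?y v else - l * el v j m)" for q v
    have dist: "i \<noteq> j" "i \<noteq> k" "i \<noteq> m" "j \<noteq> k" "j \<noteq> m" "k \<noteq> m"
      using lab by (auto simp: labelling_def)
    have p: "p i = ?x" "p j = (\<lambda>v. 0)" "p k = (\<lambda>v. - ?y v)" "p m = (\<lambda>v. - l * el v j m)"
      using dist by (auto simp: p_def fun_eq_iff)
    have ls: "l * l = 1" using A signs_square by blast
    define Q where "Q a b \<longleftrightarrow> (\<exists>s\<in>signs. \<forall>v\<in>V. el v a b = s * (p a v - p b v))" for a b
    have QI: "Q a b" if "s \<in> signs" "\<And>v. v \<in> V \<Longrightarrow> el v a b = s * (p a v - p b v)" for a b s
      using that unfolding Q_def by blast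
    have Qij: "Q i j"
      by (rule QI[OF s(1)]) (use sq in \<open>simp add: p mult.assoc[symmetric]\<close>)
    have Qjk: "Q j k"
      by (rule QI[OF s(3)]) (use sq in \<open>simp add: p mult.assoc[symmetric]\<close>)
    have Qik: "Q i k"
    proof (rule QI[OF signs_uminus[OF s(2)]])
      fix v assume "v \<in> V"
      from sum[OF this] sq show "el v i k = - s2 * (p i v - p k v)" unfolding p by algebra
    qed
    have Qjm: "Q j m"
      by (rule QI[OF A(1)]) (use ls in \<open>simp add: p mult.assoc[symmetric]\<close>)
    have Qim: "Q i m"
    proof (rule QI[OF signs_mult[OF A(2,1)]])
      fix v assume "v \<in> V"
      then have "el v i m = s * (el v j m + l * ?x v)" using A(4) by blast
      with ls show "el v i m = s * l * (p i v - p m v)" unfolding p by algebra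
    qed
    have Qkm: "Q k m"
    proof (rule QI[OF signs_mult[OF A(3,1)]])
      fix v assume "v \<in> V"
      then have "el v k m = t * (el v j m - l * ?y v)" using A(4) el_commute by metis
      with ls show "el v k m = t * l * (p k v - p m v)" unfolding p by algebra
    qed
    have sym: "Q b a" if Qab: "Q a b" for a b
    proof -
      obtain s where "s \<in> signs" "\<forall>v\<in>V. el v a b = s * (p a v - p b v)" using Qab by (auto simp: Q_def)
      then show ?thesis
        by (intro QI[of "- s"]) (auto simp: signs_uminus el_commute[of _ b a] algebra_simps)
    qed
    show ?thesis
    proof (rule subset_singA)
      fix a b :: nat assume ab: "a \<in> {1..4}" "b \<in> {1..4}" "a \<noteq> b"
      then have "a \<in> {i, j, k, m}" "b \<in> {i, j, k, m}" using labelling_eq[OF lab] by blast+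
      then have "Q a b"
        using ab(3) Qij Qik Qim Qjk Qjm Qkm sym by blast
      then show "\<exists>s\<in>signs. \<forall>x\<in>V. el x a b = s * (p a x - p b x)" by (simp add: Q_def)
    qed
  qed
qed

end

section \<open>Dimension and planar realisations of the components\<close>

lemma L24I:
  assumes lab: "labelling i j k m"
    and eqs: "(el x i j)\<^sup>2 = (x1 - x2)\<^sup>2 + (y1 - y2)\<^sup>2" "(el x i k)\<^sup>2 = (x1 - x3)\<^sup>2 + (y1 - y3)\<^sup>2"
      "(el x i m)\<^sup>2 = (x1 - x4)\<^sup>2 + (y1 - y4)\<^sup>2" "(el x j k)\<^sup>2 = (x2 - x3)\<^sup>2 + (y2 - y3)\<^sup>2"
      "(el x j m)\<^sup>2 = (x2 - x4)\<^sup>2 + (y2 - y4)\<^sup>2" "(el x k m)\<^sup>2 = (x3 - x4)\<^sup>2 + (y3 - y4)\<^sup>2"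
  shows "x \<in> L24"
proof -
  define X where "X q = (if q = i then x1 else if q = j then x2 else if q = k then x3 else x4)" for q
  define Y where "Y q = (if q = i then y1 else if q = j then y2 else if q = k then y3 else y4)" for q
  have dist: "i \<noteq> j" "i \<noteq> k" "i \<noteq> m" "j \<noteq> k" "j \<noteq> m" "k \<noteq> m"
    using lab by (auto simp: labelling_def)
  have XY: "X i = x1" "X j = x2" "X k = x3" "X m = x4" "Y i = y1" "Y j = y2" "Y k = y3" "Y m = y4"
    using dist by (auto simp: X_def Y_def)
  define Q where "Q a b \<longleftrightarrow> (el x a b)\<^sup>2 = (X a - X b)\<^sup>2 + (Y a - Y b)\<^sup>2" for a b
  have Q: "Q i j" "Q i k" "Q i m" "Q j k" "Q j m" "Q k m" unfolding Q_def XY by (fact eqs)+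
  have sym: "Q b a" if "Q a b" for a b
    using that unfolding Q_def el_commute[of x b a] by (simp add: power2_commute)
  have "Q a b" if ab: "a \<in> {1..4}" "b \<in> {1..4}" "a \<noteq> b" for a b
  proof -
    have "a \<in> {i, j, k, m}" "b \<in> {i, j, k, m}" using ab labelling_eq[OF lab] by blast+
    then show ?thesis using ab(3) Q sym by blast
  qed
  then show ?thesis
    unfolding L24_def mem_Collect_eq
    by (intro exI[of _ "\<lambda>q n. if n = 1 then X q else Y q"]) (auto simp: Q_def)
qed

text \<open>If \<open>A\<close> is nonzero, one vertex goes on the first axis at a square root of
  \<open>A\<close>, and the law of cosines gives the other. The case of nonzero \<open>B\<close> is
  symmetric.\<close>

lemma complex_triangle_exists:
  fixes A B F :: complex
  shows "\<exists>x1 y1 x2 y2. x1\<^sup>2 + y1\<^sup>2 = A \<and> x2\<^sup>2 + y2\<^sup>2 = B \<and> (x1 - x2)\<^sup>2 + (y1 - y2)\<^sup>2 = F"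
proof -
  have *: "\<exists>x1 y1 x2 y2. x1\<^sup>2 + y1\<^sup>2 = A \<and> x2\<^sup>2 + y2\<^sup>2 = B \<and> (x1 - x2)\<^sup>2 + (y1 - y2)\<^sup>2 = F"
    if "A \<noteq> 0" for A B :: complex
  proof -
    define r s t where "r = csqrt A" "s = (A + B - F) / (2 * csqrt A)" "t = csqrt (B - s\<^sup>2)"
    have "r\<^sup>2 = A" "2 * r * s = A + B - F" "t\<^sup>2 = B - s\<^sup>2" using that by (simp_all add: r_s_t_def)
    then have "r\<^sup>2 + 0\<^sup>2 = A \<and> s\<^sup>2 + t\<^sup>2 = B \<and> (r - s)\<^sup>2 + (0 - t)\<^sup>2 = F"
      by (simp add: power2_diff)
    then show ?thesis by blast
  qed
  consider "A \<noteq> 0" | "B \<noteq> 0" | "A = 0" "B = 0" by blast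
  then show ?thesis
  proof cases
    case 1
    then show ?thesis by (rule *)
  next
    case 2
    from *[OF this, of A] show ?thesis by (metis power2_commute)
  next
    case 3
    show ?thesis
    proof (intro exI conjI)
      \<comment> \<open>Two isotropic vectors on different isotropic lines, scaled so that their
        difference has squared length \<open>F\<close>.\<close>
      show "1\<^sup>2 + \<i>\<^sup>2 = A" "(- F / 4)\<^sup>2 + (\<i> * F / 4)\<^sup>2 = B" using 3 by (simp_all add: power_mult_distrib power_divide)
      show "(1 - (- F / 4))\<^sup>2 + (\<i> - \<i> * F / 4)\<^sup>2 = F" by (simp add: power2_eq_square field_simps)
    qed
  qed
qed

text \<open>Three equations in dimension six leave at least dimension three; three forms with only
  the trivial common zero on \<open>S\<close> leave at most three.\<close>

lemma dim_kernel_3: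
  fixes S :: "(complex ^ 6) set"
  assumes lin: "linform f1" "linform f2" "linform f3" "linform g1" "linform g2" "linform g3"
    and S: "S = {x. f1 x = 0 \<and> f2 x = 0 \<and> f3 x = 0}"
    and inj: "\<And>x. x \<in> S \<Longrightarrow> g1 x = 0 \<Longrightarrow> g2 x = 0 \<Longrightarrow> g3 x = 0 \<Longrightarrow> x = 0"
  shows "vec.subspace S \<and> vec.dim S = 3"
proof -
  define A1 where "A1 = {x \<in> UNIV. f1 x = 0}"
  define A2 where "A2 = {x \<in> A1. f2 x = 0}"
  define B1 where "B1 = {x \<in> S. g1 x = 0}"
  define B2 where "B2 = {x \<in> B1. g2 x = 0}"
  define B3 where "B3 = {x \<in> B2. g3 x = 0}"
  have S': "S = {x \<in> A2. f3 x = 0}" by (auto simp: S A1_def A2_def)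
  have sA1: "vec.subspace A1" unfolding A1_def by (rule subspace_kernel[OF vec.subspace_UNIV lin(1)])
  have sA2: "vec.subspace A2" unfolding A2_def by (rule subspace_kernel[OF sA1 lin(2)])
  have sS: "vec.subspace S" unfolding S' by (rule subspace_kernel[OF sA2 lin(3)])
  have sB1: "vec.subspace B1" unfolding B1_def by (rule subspace_kernel[OF sS lin(4)])
  have sB2: "vec.subspace B2" unfolding B2_def by (rule subspace_kernel[OF sB1 lin(5)])
  have "vec.dim (UNIV :: (complex ^ 6) set) = 6" unfolding vec_dim_card by simp
  moreover have "vec.dim (UNIV :: (complex ^ 6) set) \<le> Suc (vec.dim A1)"
    unfolding A1_def by (rule dim_le_Suc_dim_kernel[OF vec.subspace_UNIV lin(1)])
  moreover have "vec.dim A1 \<le> Suc (vec.dim A2)"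
    unfolding A2_def by (rule dim_le_Suc_dim_kernel[OF sA1 lin(2)])
  moreover have "vec.dim A2 \<le> Suc (vec.dim S)"
    unfolding S' by (rule dim_le_Suc_dim_kernel[OF sA2 lin(3)])
  moreover have "vec.dim S \<le> Suc (vec.dim B1)"
    unfolding B1_def by (rule dim_le_Suc_dim_kernel[OF sS lin(4)])
  moreover have "vec.dim B1 \<le> Suc (vec.dim B2)"
    unfolding B2_def by (rule dim_le_Suc_dim_kernel[OF sB1 lin(5)])
  moreover have "vec.dim B2 \<le> Suc (vec.dim B3)"
    unfolding B3_def by (rule dim_le_Suc_dim_kernel[OF sB2 lin(6)])
  moreover have "B3 \<subseteq> {0}" using inj by (auto simp: B1_def B2_def B3_def)
  then have "vec.dim B3 = 0" unfolding vec.dim_eq_0 .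
  ultimately show ?thesis using sS by linarith
qed

lemma singA_flat:
  assumes s: "s13 \<in> signs" "s14 \<in> signs" "s23 \<in> signs" "s24 \<in> signs" "s34 \<in> signs"
  shows "vec.subspace (singA s13 s14 s23 s24 s34) \<and> vec.dim (singA s13 s14 s23 s24 s34) = 3"
    and "singA s13 s14 s23 s24 s34 \<subseteq> L24"
proof -
  have lab: "labelling 1 2 3 4" by (auto simp: labelling_def)
  have nz: "s13 \<noteq> 0" "s14 \<noteq> 0" "s23 \<noteq> 0" "s24 \<noteq> 0" "s34 \<noteq> 0" using s by (auto simp: signs_def)
  show "vec.subspace (singA s13 s14 s23 s24 s34) \<and> vec.dim (singA s13 s14 s23 s24 s34) = 3"
  proof (rule dim_kernel_3[OF _ _ _ linform_el[of 1 2] linform_el[of 1 3] linform_el[of 1 4] singA_def])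
    fix x assume "x \<in> singA s13 s14 s23 s24 s34" "el x 1 2 = 0" "el x 1 3 = 0" "el x 1 4 = 0"
    then show "x = 0" using nz by (intro el_eq_0[OF lab]) (auto simp: singA_def)
  qed (intro linform_intros linform_el)+
  show "singA s13 s14 s23 s24 s34 \<subseteq> L24"
  proof
    fix x assume x: "x \<in> singA s13 s14 s23 s24 s34"
    have sq: "s13\<^sup>2 = 1" "s14\<^sup>2 = 1" "s23\<^sup>2 = 1" "s24\<^sup>2 = 1" "s34\<^sup>2 = 1"
      using s by (auto simp: signs_def)
    have e: "el x 1 2 - s13 * el x 1 3 = - (s23 * el x 2 3)"
       "el x 1 2 - s14 * el x 1 4 = - (s24 * el x 2 4)"
       "s13 * el x 1 3 - s14 * el x 1 4 = - (s34 * el x 3 4)"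
      using x by (simp_all add: singA_def eq_neg_iff_add_eq_0)
    show "x \<in> L24"
      \<comment> \<open>Four collinear points on the first axis, with vertex 1 at the
        origin.\<close>
      by (rule L24I[OF lab, of x 0 "el x 1 2" 0 0 "s13 * el x 1 3" 0 "s14 * el x 1 4" 0])
        (simp_all add: e sq power_mult_distrib del: One_nat_def)
  qed
qed

lemma singB_flat:
  assumes lab: "labelling a b c e" and s: "s \<in> signs" "t \<in> signs"
  shows "vec.subspace (singB a b c e s t) \<and> vec.dim (singB a b c e s t) = 3"
    and "singB a b c e s t \<subseteq> L24"
proof -
  have "vec.subspace {x. el x a b = 0 \<and> el x a c - s * el x b c = 0 \<and> el x a e - t * el x b e = 0}
    \<and> vec.dim {x. el x a b = 0 \<and> el x a c - s * el x b c = 0 \<and> el x a e - t * el x b e = 0} = 3"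
  proof (rule dim_kernel_3[OF _ _ _ linform_el[of b c] linform_el[of b e] linform_el[of c e] refl])
    fix x assume "x \<in> {x. el x a b = 0 \<and> el x a c - s * el x b c = 0 \<and> el x a e - t * el x b e = 0}"
      "el x b c = 0" "el x b e = 0" "el x c e = 0"
    then show "x = 0" by (intro el_eq_0[OF lab]) auto
  qed (intro linform_intros linform_el)+
  then show "vec.subspace (singB a b c e s t) \<and> vec.dim (singB a b c e s t) = 3"
    by (simp add: singB_def)
  show "singB a b c e s t \<subseteq> L24"
  proof
    fix x assume x: "x \<in> singB a b c e s t"
    obtain x1 y1 x2 y2 where xy: "x1\<^sup>2 + y1\<^sup>2 = (el x b c)\<^sup>2" "x2\<^sup>2 + y2\<^sup>2 = (el x b e)\<^sup>2"
      "(x1 - x2)\<^sup>2 + (y1 - y2)\<^sup>2 = (el x c e)\<^sup>2"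
      using complex_triangle_exists by blast
    have e: "el x a b = 0" "el x a c = s * el x b c" "el x a e = t * el x b e" using x by (simp_all add: singB_def)
    have sq: "s\<^sup>2 = 1" "t\<^sup>2 = 1" using s by (auto simp: signs_def)
    show "x \<in> L24"
      \<comment> \<open>Vertices \<open>a\<close> and \<open>b\<close> coincide at the origin;
        \<open>c\<close> and \<open>e\<close> complete the triangle found above.\<close>
      by (rule L24I[OF lab, of x 0 0 0 0 x1 y1 x2 y2]) (simp_all add: e sq xy power_mult_distrib)
  qed
qed

lemma singC_flat:
  assumes "distinct [a, b, c]" "{a, b, c} \<subseteq> {1..4}"
  shows "vec.subspace (singC a b c) \<and> vec.dim (singC a b c) = 3" and "singC a b c \<subseteq> L24"
proof -
  have "card {a, b, c} < card {1..4::nat}" using card_length[of "[a, b, c]"] by simp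
  then have "\<not> {1..4} \<subseteq> {a, b, c}" using card_mono[of "{a, b, c}" "{1..4}"] by auto
  then obtain e where "e \<in> {1..4}" "e \<notin> {a, b, c}" by blast
  then have lab: "labelling a b c e" using assms by (auto simp: labelling_def)
  show "vec.subspace (singC a b c) \<and> vec.dim (singC a b c) = 3"
  proof (rule dim_kernel_3[OF _ _ _ linform_el[of a e] linform_el[of b e] linform_el[of c e] singC_def])
    fix x assume "x \<in> singC a b c" "el x a e = 0" "el x b e = 0" "el x c e = 0"
    then show "x = 0" by (intro el_eq_0[OF lab]) (auto simp: singC_def)
  qed (rule linform_el)+
  show "singC a b c \<subseteq> L24"
  proof
    fix x assume x: "x \<in> singC a b c"
    have e: "el x a b = 0" "el x a c = 0" "el x b c = 0" using x by (simp_all add: singC_def)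
    \<comment> \<open>The vertices \<open>a\<close>, \<open>b\<close>, \<open>c\<close> go on the
      isotropic line of direction \<open>(1, \<i>)\<close>, where all distances vanish, and
      \<open>e\<close> to \<open>(1, 0)\<close>. The equation for the distance to \<open>e\<close>
      is then linear in the parameter \<open>r q\<close>.\<close>
    define r where "r q = (1 - (el x q e)\<^sup>2) / 2" for q
    have apex: "(el x q e)\<^sup>2 = (r q - 1)\<^sup>2 + (\<i> * r q - 0)\<^sup>2" for q
      by (simp add: r_def power2_eq_square field_simps)
    have isotropic: "0\<^sup>2 = (u - v)\<^sup>2 + (\<i> * u - \<i> * v)\<^sup>2" for u v
      by (simp add: power2_eq_square algebra_simps)
    show "x \<in> L24"
      by (rule L24I[OF lab, of x "r a" "r b" "\<i> * r a" "\<i> * r b" "r c" "\<i> * r c" 1 0])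
        (simp_all only: e apex isotropic)
  qed
qed

lemma sing_components_flat:
  assumes "S \<in> sing_components"
  shows "vec.subspace S \<and> vec.dim S = 3 \<and> S \<subseteq> L24"
  using assms unfolding sing_components_def
proof (elim UnE CollectE exE conjE)
  fix s13 s14 s23 s24 s34
  assume "S = singA s13 s14 s23 s24 s34" "s13 \<in> signs" "s14 \<in> signs" "s23 \<in> signs" "s24 \<in> signs" "s34 \<in> signs"
  then show ?thesis by (simp add: singA_flat)
next
  fix a b c e s t
  assume S: "S = singB a b c e s t" and "distinct [a, b, c, e]" "{a, b, c, e} = {1..4}" and s: "s \<in> signs" "t \<in> signs"
  then have lab: "labelling a b c e" by (simp add: labelling_def)
  show ?thesis unfolding S using singB_flat[OF lab s] by simp
next
  fix a b c
  assume S: "S = singC a b c" and abc: "distinct [a, b, c]" "{a, b, c} \<subseteq> {1..4}"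
  show ?thesis unfolding S using singC_flat[OF abc] by simp
qed

theorem theoremB2:
  shows "{V :: (complex ^ 6) set. vec.subspace V \<and> vec.dim V = 3 \<and> V \<subseteq> L24} = sing_components
    \<and> (\<forall>V :: (complex ^ 6) set. vec.subspace V \<and> V \<subseteq> L24 \<longrightarrow> vec.dim V < 4)"
proof -
  \<comment> \<open>Components have dimension exactly three, so this containment yields equality in
    dimension three and excludes larger dimensions.\<close>
  have subset: "\<exists>S\<in>sing_components. V \<subseteq> S"
    if "vec.subspace V" "3 \<le> vec.dim V" "V \<subseteq> L24" for V :: "(complex ^ 6) set"
  proof -
    interpret flat_in_L24 V using that by unfold_locales
    show ?thesis by (rule subset_component)
  qed
  have "V \<in> sing_components"
    if V: "vec.subspace V" "vec.dim V = 3" "V \<subseteq> L24" for V :: "(complex ^ 6) set"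
  proof -
    obtain S where S: "S \<in> sing_components" "V \<subseteq> S" using subset[of V] V by auto
    then have "V = S"
      using V sing_components_flat[OF S(1)] by (intro vec.subspace_dim_equal) auto
    then show ?thesis using S by simp
  qed
  moreover have "vec.dim V < 4" if V: "vec.subspace V" "V \<subseteq> L24" for V :: "(complex ^ 6) set"
  proof (rule ccontr)
    assume "\<not> vec.dim V < 4"
    then obtain S where S: "S \<in> sing_components" "V \<subseteq> S" using subset[of V] V by auto
    then have "vec.dim V \<le> 3" using vec.dim_subset[OF S(2)] sing_components_flat[OF S(1)] by simp
    then show False using \<open>\<not> vec.dim V < 4\<close> by simp
  qed
  ultimately show ?thesis using sing_components_flat by blast
qed

end
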